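(* Let $\mathcal K$ be a simplicial complex on the vertex set $[m]$. If $\mathcal K\ne\Delta^{m-1}$ (the full simplex on $[m]$), then the Euler characteristic of $\mathit{HH}^*(\mathcal Z_{\mathcal K})$ is zero.
   Context: A simplicial complex $\mathcal K$ on the vertex set $[m]=\{1,\dots,m\}$ contains $\varnothing$ and all singletons. For $I\subset[m]$ the full subcomplex is $\mathcal K_I=\{J\in\mathcal K: J\subset I\}$. All (co)homology has $\mathbb Z$ coefficients; $\widetilde H^*$ is reduced simplicial cohomology, with $\widetilde H^{-1}(\mathcal K_\varnothing)=\mathbb Z$. Moment-angle complex: $\mathcal Z_{\mathcal K}=\bigcup_{I\in\mathcal K}\{z\in(D^2)^m: |z_j|=1\text{ if }j\notin I\}$. Its cohomology has the bigraded Hochster decomposition $H^{-k,2\ell}(\mathcal Z_{\mathcal K})=\bigoplus_{I\subset[m],|I|=\ell}\widetilde H^{\ell-k-1}(\mathcal K_I)$, of total degree $-k+2\ell$. Double cohomology: for $i\in I$ let $\psi_{p;i,I}:\widetilde H^p(\mathcal K_I)\to\widetilde H^p(\mathcal K_{I\setminus\{i\}})$ be induced by inclusion, let $\varepsilon(i,I)=(-1)^{\#\{r\in I: r<i\}}$, and define $d'$ on $\widetilde H^p(\mathcal K_I)$ by $d'=(-1)^{p+1}\sum_{i\in I}\varepsilon(i,I)\psi_{p;i,I}$. Then $d':H^{-k,2\ell}(\mathcal Z_{\mathcal K})\to H^{-k+1,2\ell-2}(\mathcal Z_{\mathcal K})$, $(d')^2=0$, and $\mathit{HH}^{-k,2\ell}(\mathcal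 Z_{\mathcal K})$ denotes the cohomology of $(H^*(\mathcal Z_{\mathcal K}),d')$ at bidegree $(-k,2\ell)$. The Euler characteristic of $\mathit{HH}^*(\mathcal Z_{\mathcal K})$ is $\sum_{k,\ell}(-1)^{-k+2\ell}\operatorname{rank}\mathit{HH}^{-k,2\ell}(\mathcal Z_{\mathcal K})$. *)

theory Defs
  imports "HOL-Algebra.Product_Groups" "HOL-Algebra.FiniteProduct"
begin

text \<open>Abelian groups are HOL-Algebra monoid records in multiplicative notation, as in
  HOL-Homology: the group operation is the sum of (co)chains, and \<open>x [^] n\<close> is \<open>n\<close> times \<open>x\<close>.\<close>

subsection \<open>Simplicial complexes\<close>

definition complex_on :: "nat \<Rightarrow> nat set set \<Rightarrow> bool" where
  "complex_on m K \<longleftrightarrow>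
     K \<subseteq> Pow {1..m} \<and> {} \<in> K \<and> (\<forall>i\<in>{1..m}. {i} \<in> K) \<and> (\<forall>J\<in>K. \<forall>J'. J' \<subseteq> J \<longrightarrow> J' \<in> K)"

definition full_subcomplex :: "nat set set \<Rightarrow> nat set \<Rightarrow> nat set set" where
  "full_subcomplex K I = {J \<in> K. J \<subseteq> I}"

text \<open>The dimension \<open>p\<close> is an integer; the empty set is the unique simplex of dimension \<open>-1\<close>.\<close>

definition simplices :: "nat set set \<Rightarrow> int \<Rightarrow> nat set set" where
  "simplices L p = {J \<in> L. finite J \<and> int (card J) = p + 1}"

definition eps :: "nat \<Rightarrow> nat set \<Rightarrow> int" where
  "eps i I = (- 1) ^ card {r \<in> I. r < i}"

text \<open>\<open>(-1)\<^sup>n\<close> for an integer exponent.\<close>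

definition neg_one_power :: "int \<Rightarrow> int" where
  "neg_one_power n = (if even n then 1 else - 1)"

subsection \<open>Reduced simplicial cohomology with integer coefficients\<close>

text \<open>Cohomology at the middle term of \<open>A \<rightarrow> B \<rightarrow> C\<close>, the maps being \<open>f\<close> and \<open>g\<close>.\<close>

definition cohomology_at ::
    "('a, 'p) monoid_scheme \<Rightarrow> ('b, 'q) monoid_scheme \<Rightarrow> ('c, 'r) monoid_scheme \<Rightarrow>
     ('a \<Rightarrow> 'b) \<Rightarrow> ('b \<Rightarrow> 'c) \<Rightarrow> 'b set monoid" where
  "cohomology_at A B C f g = subgroup_generated B (kernel B C g) Mod (f ` carrier A)"

text \<open>A \<open>p\<close>-cochain is an integer function on the \<open>p\<close>-simplices, extended by zero. Simplices are
  oriented by the natural order of the vertices, so the sign of the facet \<open>J - {j}\<close> in the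
  boundary of \<open>J\<close> is \<open>eps j J\<close>. Since \<open>-1\<close>-cochains are included, the cohomology is reduced.\<close>

definition cochain_group :: "nat set set \<Rightarrow> int \<Rightarrow> (nat set \<Rightarrow> int) monoid" where
  "cochain_group L p =
     \<lparr>carrier = {c. \<forall>J. J \<notin> simplices L p \<longrightarrow> c J = 0},
      monoid.mult = (\<lambda>a b J. a J + b J), one = (\<lambda>J. 0)\<rparr>"

definition coboundary :: "nat set set \<Rightarrow> int \<Rightarrow> (nat set \<Rightarrow> int) \<Rightarrow> nat set \<Rightarrow> int" where
  "coboundary L p c =
     (\<lambda>J. if J \<in> simplices L (p + 1) then \<Sum>j\<in>J. eps j J * c (J - {j}) else 0)"

definition red_cohomology :: "nat set set \<Rightarrow> int \<Rightarrow> (nat set \<Rightarrow> int) set monoid" where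
  "red_cohomology L p =
     cohomology_at (cochain_group L (p - 1)) (cochain_group L p) (cochain_group L (p + 1))
       (coboundary L (p - 1)) (coboundary L p)"

definition restrict_cochain :: "nat set set \<Rightarrow> int \<Rightarrow> (nat set \<Rightarrow> int) \<Rightarrow> nat set \<Rightarrow> int" where
  "restrict_cochain L p c = (\<lambda>J. if J \<in> simplices L p then c J else 0)"

text \<open>The map from the cohomology of a complex to that of a subcomplex \<open>L\<close> induced by the
  inclusion. On a coset \<open>X\<close> of cocycles all the cosets in the union coincide, so the union is the
  class of the restriction of any representative of \<open>X\<close>.\<close>

definition red_cohomology_restrict ::
    "nat set set \<Rightarrow> int \<Rightarrow> (nat set \<Rightarrow> int) set \<Rightarrow> (nat set \<Rightarrow> int) set" where
  "red_cohomology_restrict L p X =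
     (\<Union>c\<in>X. (coboundary L (p - 1) ` carrier (cochain_group L (p - 1)))
               #>\<^bsub>cochain_group L p\<^esub> restrict_cochain L p c)"

definition psi ::
    "nat set set \<Rightarrow> int \<Rightarrow> nat \<Rightarrow> nat set \<Rightarrow> (nat set \<Rightarrow> int) set \<Rightarrow> (nat set \<Rightarrow> int) set" where
  "psi K p i I = red_cohomology_restrict (full_subcomplex K (I - {i})) p"

subsection \<open>Bigraded cohomology of the moment-angle complex and double cohomology\<close>

definition vertex_subsets :: "nat \<Rightarrow> int \<Rightarrow> nat set set" where
  "vertex_subsets m l = {I. I \<subseteq> {1..m} \<and> int (card I) = l}"

text \<open>\<open>H_ZK m K k l\<close> is \<open>H\<^sup>-\<^sup>k\<^sup>,\<^sup>2\<^sup>l\<close> of the moment-angle complex of \<open>K\<close>, in its Hochster decomposition;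
  similarly, \<open>HH_ZK m K k l\<close> is \<open>HH\<^sup>-\<^sup>k\<^sup>,\<^sup>2\<^sup>l\<close>. The groups are defined for all integers \<open>k\<close> and \<open>l\<close>.\<close>

definition H_ZK ::
    "nat \<Rightarrow> nat set set \<Rightarrow> int \<Rightarrow> int \<Rightarrow> (nat set \<Rightarrow> (nat set \<Rightarrow> int) set) monoid" where
  "H_ZK m K k l =
     sum_group (vertex_subsets m l) (\<lambda>I. red_cohomology (full_subcomplex K I) (l - k - 1))"

text \<open>The differential from \<open>H_ZK m K k l\<close> to \<open>H_ZK m K (k - 1) (l - 1)\<close>, given by its components:
  the summand indexed by \<open>I'\<close> receives a contribution from \<open>I = I' \<union> {i}\<close> for each vertex \<open>i\<close>
  not in \<open>I'\<close>. The simplicial degree \<open>p = l - k - 1\<close> is preserved.\<close>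

definition dprime ::
    "nat \<Rightarrow> nat set set \<Rightarrow> int \<Rightarrow> int \<Rightarrow>
     (nat set \<Rightarrow> (nat set \<Rightarrow> int) set) \<Rightarrow> nat set \<Rightarrow> (nat set \<Rightarrow> int) set" where
  "dprime m K k l x =
     (let p = l - k - 1 in
      (\<lambda>I'\<in>vertex_subsets m (l - 1).
        finprod (red_cohomology (full_subcomplex K I') p)
          (\<lambda>i. psi K p i (insert i I') (x (insert i I'))
                 [^]\<^bsub>red_cohomology (full_subcomplex K I') p\<^esub>
               (neg_one_power (p + 1) * eps i (insert i I')))
          ({1..m} - I')))"

definition HH_ZK ::
    "nat \<Rightarrow> nat set set \<Rightarrow> int \<Rightarrow> int \<Rightarrow> (nat set \<Rightarrow> (nat set \<Rightarrow> int) set) set monoid" where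
  "HH_ZK m K k l =
     cohomology_at (H_ZK m K (k + 1) (l + 1)) (H_ZK m K k l) (H_ZK m K (k - 1) (l - 1))
       (dprime m K (k + 1) (l + 1)) (dprime m K k l)"

subsection \<open>Rank and Euler characteristic\<close>

definition int_independent :: "('a, 'b) monoid_scheme \<Rightarrow> 'a set \<Rightarrow> bool" where
  "int_independent G S \<longleftrightarrow>
     (\<forall>n :: 'a \<Rightarrow> int. finprod G (\<lambda>s. s [^]\<^bsub>G\<^esub> n s) S = \<one>\<^bsub>G\<^esub> \<longrightarrow> (\<forall>s\<in>S. n s = 0))"

text \<open>The maximal size of a linearly independent subset over the integers. The maximum exists
  for finitely generated abelian groups, the only groups to which this is applied.\<close>

definition abelian_rank :: "('a, 'b) monoid_scheme \<Rightarrow> nat" where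
  "abelian_rank G =
     (GREATEST n. \<exists>S. finite S \<and> S \<subseteq> carrier G \<and> card S = n \<and> int_independent G S)"

text \<open>The range of summation is no restriction. If \<open>HH_ZK m K k l\<close> is nontrivial, then some
  \<open>I \<subseteq> {1..m}\<close> with \<open>l\<close> elements has nonzero cohomology in dimension \<open>l - k - 1\<close>. This
  dimension is at least \<open>-1\<close> and at most \<open>l - 1\<close>, so \<open>0 \<le> k \<le> l \<le> m\<close>.\<close>

definition HH_euler_characteristic :: "nat \<Rightarrow> nat set set \<Rightarrow> int" where
  "HH_euler_characteristic m K =
     (\<Sum>k\<in>{0..int m}. \<Sum>l\<in>{0..int m}.
        neg_one_power (- k + 2 * l) * int (abelian_rank (HH_ZK m K k l)))"

end

theory Submission
  imports Defs
begin

text \<open>Taking cohomology of a bounded complex of finitely generated abelian groups does not change the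
  alternating sum of the ranks, because rank is additive on short exact sequences. This is applied
  twice. First, \<open>HH\<close> is the cohomology of \<open>d'\<close> on the Hochster groups, so its Euler characteristic
  is the alternating sum of the ranks of the groups \<open>H_ZK\<close>
  (\<open>HH_euler_characteristic_eq\<close>). Secondly, the reduced cohomology of each full subcomplex \<open>K\<^sub>I\<close> is
  computed by its simplicial cochains, so its ranks may be replaced by the numbers of simplices
  (\<open>euler_full_subcomplex\<close>). What remains is the double sum of the signs
  \<open>(-1)\<^bsup>|I| + |J|\<^esup>\<close> over all \<open>J \<in> K\<close> and all \<open>I\<close> with \<open>J \<subseteq> I \<subseteq> {1..m}\<close>. For a fixed \<open>J\<close> the
  inner sum over \<open>I\<close> vanishes unless \<open>J\<close> is all of \<open>{1..m}\<close>, and \<open>{1..m}\<close> is a simplex only of the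
  full simplex.

  The rank of an abelian group is the largest size of an independent set, so additivity needs some
  linear algebra over the integers: an independent set is no larger than a set whose multiples
  span up to torsion (\<open>card_independent_le\<close>), and bases of the two ends of a short exact
  sequence combine to a basis of the middle (\<open>rank_short_exact\<close>). To treat the Hochster groups as a
  complex one also needs that the maps \<open>\<psi>\<close> are homomorphisms compatible with composition, after
  which \<open>d' \<circ> d' = 0\<close> is the usual cancellation of signs (\<open>d_total_d_total\<close>).\<close>

section \<open>Finite products in abelian groups\<close>

lemma (in comm_group) finprod_swap:
  assumes "finite A" "finite B" "\<And>a b. a \<in> A \<Longrightarrow> b \<in> B \<Longrightarrow> f a b \<in> carrier G"
  shows "finprod G (\<lambda>a. finprod G (f a) B) A = finprod G (\<lambda>b. finprod G (\<lambda>a. f a b) A) B"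
  using assms(1,3)
proof (induction A rule: finite_induct)
  case (insert x F)
  have "finprod G (\<lambda>b. finprod G (\<lambda>a. f a b) (insert x F)) B
      = finprod G (\<lambda>b. f x b \<otimes> finprod G (\<lambda>a. f a b) F) B"
    using insert by (intro finprod_cong) (auto simp: Pi_iff)
  also have "\<dots> = finprod G (f x) B \<otimes> finprod G (\<lambda>b. finprod G (\<lambda>a. f a b) F) B"
    using insert by (intro finprod_multf) (auto simp: Pi_iff)
  finally show ?case using insert by (simp add: Pi_iff)
qed simp

lemma hom_finprod:
  assumes "comm_group G" "comm_group H" "h \<in> hom G H" "\<And>a. a \<in> A \<Longrightarrow> f a \<in> carrier G"
  shows "h (finprod G f A) = finprod H (\<lambda>a. h (f a)) A"
proof -
  interpret G: comm_group G by fact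
  interpret H: comm_group H by fact
  interpret h: group_hom G H h
    using assms(3) by unfold_locales
  show ?thesis
    using assms(4)
    by (induction A rule: infinite_finite_induct) (auto simp: Pi_iff)
qed

lemma (in comm_group) finprod_int_pow:
  assumes "\<And>a. a \<in> A \<Longrightarrow> f a \<in> carrier G"
  shows "finprod G f A [^] (n::int) = finprod G (\<lambda>a. f a [^] n) A"
  using assms by (intro hom_finprod) (auto simp: comm_group_axioms hom_def int_pow_distrib)

lemma (in comm_group) finprod_int_pow_sum:
  assumes "x \<in> carrier G" "finite A"
  shows "finprod G (\<lambda>a. x [^] (c a :: int)) A = x [^] (\<Sum>a\<in>A. c a)"
  using assms(2,1) by (induction A rule: finite_induct) (auto simp: int_pow_mult Pi_iff)

section \<open>Ranks of abelian groups\<close>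

text \<open>More integer vectors than coordinates are linearly dependent over the integers. The proof is
  fraction-free Gaussian elimination: a vector with nonzero entry at \<open>b0\<close> serves as pivot to clear
  that coordinate from all the others.\<close>

lemma integer_dependence:
  fixes a :: "'s \<Rightarrow> 'b \<Rightarrow> int"
  assumes "finite B" "finite S" "card B < card S"
  shows "\<exists>x. (\<exists>s\<in>S. x s \<noteq> 0) \<and> (\<forall>b\<in>B. (\<Sum>s\<in>S. x s * a s b) = 0)"
  using assms
proof (induction B arbitrary: S a rule: finite_induct)
  case empty
  then have "S \<noteq> {}" by auto
  then show ?case by (intro exI[of _ "\<lambda>_. 1"]) auto
next
  case (insert b0 B)
  show ?case
  proof (cases "\<forall>s\<in>S. a s b0 = 0")
    case True
    from insert.IH[OF insert.prems(1), of a] insert.prems insert.hyps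
    obtain x where "\<exists>s\<in>S. x s \<noteq> 0" "\<forall>b\<in>B. (\<Sum>s\<in>S. x s * a s b) = 0" by auto
    with True show ?thesis by (intro exI[of _ x]) auto
  next
    case False
    then obtain s0 where s0: "s0 \<in> S" "a s0 b0 \<noteq> 0" by auto
    let ?a = "\<lambda>s b. a s0 b0 * a s b - a s b0 * a s0 b"
    have "card B < card (S - {s0})" using insert.prems insert.hyps s0 by auto
    from insert.IH[OF _ this, of ?a] insert.prems
    obtain x where x: "\<exists>s\<in>S - {s0}. x s \<noteq> 0"
      and x0: "\<forall>b\<in>B. (\<Sum>s\<in>S - {s0}. x s * ?a s b) = 0" by auto
    \<comment> \<open>a relation among the reduced vectors, rewritten as one among the original vectors\<close>
    define y where "y s = (if s = s0 then - (\<Sum>s\<in>S - {s0}. x s * a s b0) else a s0 b0 * x s)" for s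
    have y: "(\<Sum>s\<in>S. y s * a s b) = (\<Sum>s\<in>S - {s0}. x s * ?a s b)" for b
    proof -
      have "(\<Sum>s\<in>S. y s * a s b) = y s0 * a s0 b + (\<Sum>s\<in>S - {s0}. y s * a s b)"
        using insert.prems s0 by (simp add: sum.remove)
      also have "(\<Sum>s\<in>S - {s0}. y s * a s b) = (\<Sum>s\<in>S - {s0}. a s0 b0 * x s * a s b)"
        by (intro sum.cong) (auto simp: y_def)
      also have "y s0 * a s0 b = - (\<Sum>s\<in>S - {s0}. x s * a s b0 * a s0 b)"
        by (simp add: y_def sum_distrib_right)
      finally show ?thesis by (simp add: sum_subtractf algebra_simps)
    qed
    have "(\<Sum>s\<in>S - {s0}. x s * ?a s b0) = 0" by (simp add: mult.commute)
    with y x0 have "\<forall>b\<in>insert b0 B. (\<Sum>s\<in>S. y s * a s b) = 0" by auto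
    moreover have "\<exists>s\<in>S. y s \<noteq> 0" using x s0 by (auto simp: y_def)
    ultimately show ?thesis by blast
  qed
qed

text \<open>Over the rationals, such a set spans: every element has a nonzero multiple in the subgroup
  generated by \<open>B\<close>.\<close>

definition torsion_spans :: "('a, 'b) monoid_scheme \<Rightarrow> 'a set \<Rightarrow> bool" where
  "torsion_spans G B \<longleftrightarrow>
     (\<forall>g\<in>carrier G. \<exists>(n::int) c. n \<noteq> 0 \<and> g [^]\<^bsub>G\<^esub> n = finprod G (\<lambda>b. b [^]\<^bsub>G\<^esub> (c b :: int)) B)"

text \<open>A finite set that becomes a basis of \<open>G\<close> tensored with the rationals. Working with such sets avoids
  both tensor products and the classification of finitely generated abelian groups.\<close>

definition rational_basis :: "('a, 'b) monoid_scheme \<Rightarrow> 'a set \<Rightarrow> bool" where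
  "rational_basis G B \<longleftrightarrow>
     finite B \<and> B \<subseteq> carrier G \<and> int_independent G B \<and> torsion_spans G B"

definition finite_rank :: "('a, 'b) monoid_scheme \<Rightarrow> bool" where
  "finite_rank G \<longleftrightarrow> comm_group G \<and> (\<exists>B. rational_basis G B)"

lemma int_independentD:
  fixes n :: "'a \<Rightarrow> int"
  assumes "int_independent G S" "finprod G (\<lambda>s. s [^]\<^bsub>G\<^esub> n s) S = \<one>\<^bsub>G\<^esub>"
  shows "\<forall>s\<in>S. n s = 0"
  using assms unfolding int_independent_def by blast

text \<open>The Steinitz bound. Clearing denominators, a multiple of each element of \<open>S\<close> is a combination of
  \<open>B\<close>; if \<open>S\<close> were larger, the coefficient vectors would be dependent, and hence so would \<open>S\<close>.\<close>

lemma (in comm_group) card_independent_le: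
  assumes B: "finite B" "B \<subseteq> carrier G" "torsion_spans G B"
    and S: "finite S" "S \<subseteq> carrier G" "int_independent G S"
  shows "card S \<le> card B"
proof (rule ccontr)
  assume "\<not> card S \<le> card B"
  then have lt: "card B < card S" by simp
  have "\<forall>s\<in>S. \<exists>(n::int) c. n \<noteq> 0 \<and> s [^] n = finprod G (\<lambda>b. b [^] (c b :: int)) B"
    using B(3) S(2) unfolding torsion_spans_def by blast
  then obtain n a where na: "\<And>s. s \<in> S \<Longrightarrow> (n s :: int) \<noteq> 0"
      "\<And>s. s \<in> S \<Longrightarrow> s [^] n s = finprod G (\<lambda>b. b [^] (a s b :: int)) B"
    by metis
  obtain x where x: "\<exists>s\<in>S. x s \<noteq> 0" "\<forall>b\<in>B. (\<Sum>s\<in>S. x s * a s b) = 0"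
    using integer_dependence[OF B(1) S(1) lt] by blast
  have [simp]: "\<And>s. s \<in> S \<Longrightarrow> s \<in> carrier G" "\<And>b. b \<in> B \<Longrightarrow> b \<in> carrier G"
    using S B by auto
  have "finprod G (\<lambda>s. s [^] (n s * x s)) S
      = finprod G (\<lambda>s. finprod G (\<lambda>b. b [^] (x s * a s b)) B) S"
  proof (intro finprod_cong' refl)
    show "s [^] (n s * x s) = finprod G (\<lambda>b. b [^] (x s * a s b)) B" if "s \<in> S" for s
    proof -
      have "s [^] (n s * x s) = (s [^] n s) [^] x s"
        using that by (simp add: int_pow_pow)
      also have "\<dots> = finprod G (\<lambda>b. (b [^] a s b) [^] x s) B"
        using that by (simp add: na finprod_int_pow)
      also have "\<dots> = finprod G (\<lambda>b. b [^] (x s * a s b)) B"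
        by (intro finprod_cong) (auto simp: int_pow_pow mult.commute)
      finally show ?thesis .
    qed
  qed (auto simp: Pi_iff)
  also have "\<dots> = finprod G (\<lambda>b. finprod G (\<lambda>s. b [^] (x s * a s b)) S) B"
    using B S by (intro finprod_swap) auto
  also have "\<dots> = \<one>"
  proof (rule finprod_one_eqI)
    show "finprod G (\<lambda>s. b [^] (x s * a s b)) S = \<one>" if "b \<in> B" for b
      using that x(2) S(1) by (simp add: finprod_int_pow_sum)
  qed
  finally have "\<forall>s\<in>S. n s * x s = 0"
    by (rule int_independentD[OF S(3)])
  with na x show False by auto
qed

lemma abelian_rank_eq_card:
  assumes "comm_group G" "rational_basis G B"
  shows "abelian_rank G = card B"
  unfolding abelian_rank_def
proof (rule Greatest_equality)
  show "\<exists>S. finite S \<and> S \<subseteq> carrier G \<and> card S = card B \<and> int_independent G S"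
    using assms(2) unfolding rational_basis_def by blast
  show "n \<le> card B" if "\<exists>S. finite S \<and> S \<subseteq> carrier G \<and> card S = n \<and> int_independent G S" for n
    using that assms comm_group.card_independent_le[OF assms(1)]
    unfolding rational_basis_def by blast
qed

text \<open>A largest independent set is a rational basis, since enlarging it by any \<open>g\<close> creates a relation in
  which \<open>g\<close> must occur.\<close>

lemma (in comm_group) finite_rank_if_bounded:
  assumes bound: "\<And>S. finite S \<Longrightarrow> S \<subseteq> carrier G \<Longrightarrow> int_independent G S \<Longrightarrow> card S \<le> N"
  shows "finite_rank G"
proof -
  let ?P = "\<lambda>k. \<exists>S. finite S \<and> S \<subseteq> carrier G \<and> int_independent G S \<and> card S = k"
  have "?P 0" by (intro exI[of _ "{}"]) (auto simp: int_independent_def)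
  moreover have le: "\<forall>k. ?P k \<longrightarrow> k \<le> N" using bound by auto
  ultimately have "?P (GREATEST k. ?P k)" using GreatestI_nat[of ?P 0 N] by blast
  then obtain S where S: "finite S" "S \<subseteq> carrier G" "int_independent G S"
    and card: "card S = (GREATEST k. ?P k)" by blast
  have max: "card T \<le> card S" if "finite T" "T \<subseteq> carrier G" "int_independent G T" for T
    unfolding card using le that by (intro Greatest_le_nat) auto
  have [simp]: "\<And>s. s \<in> S \<Longrightarrow> s \<in> carrier G" using S by auto
  have "torsion_spans G S"
    unfolding torsion_spans_def
  proof
    fix g assume g: "g \<in> carrier G"
    show "\<exists>(n::int) c. n \<noteq> 0 \<and> g [^] n = finprod G (\<lambda>b. b [^] (c b :: int)) S"
    proof (cases "g \<in> S")
      case True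
      have "finprod G (\<lambda>b. b [^] (if b = g then 1 else 0 :: int)) S
          = finprod G (\<lambda>b. if g = b then b else \<one>) S"
        using g by (intro finprod_cong') auto
      also have "\<dots> = g" using finprod_singleton[OF True S(1), of "\<lambda>b. b"] by (auto simp: Pi_iff)
      finally show ?thesis using g by (intro exI[of _ 1] exI[of _ "\<lambda>b. if b = g then 1 else 0"]) simp
    next
      case False
      have "\<not> int_independent G (insert g S)"
        using max[of "insert g S"] S g False by auto
      then obtain n where n: "finprod G (\<lambda>s. s [^] (n s :: int)) (insert g S) = \<one>"
          "\<exists>s\<in>insert g S. n s \<noteq> 0"
        unfolding int_independent_def by blast
      have eq: "g [^] n g \<otimes> finprod G (\<lambda>s. s [^] n s) S = \<one>"
        using n(1) False S(1) g by (simp add: Pi_iff)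
      have "n g \<noteq> 0"
      proof
        assume "n g = 0"
        with eq have "finprod G (\<lambda>s. s [^] n s) S = \<one>" by (simp add: Pi_iff)
        with S(3) have "\<forall>s\<in>S. n s = 0" unfolding int_independent_def by blast
        with n(2) \<open>n g = 0\<close> show False by auto
      qed
      have "g [^] (- n g) = finprod G (\<lambda>s. s [^] n s) S"
        using eq g by (metis (no_types, lifting) finprod_closed int_pow_closed int_pow_neg inv_equality inv_inv
            Pi_I S(2) subsetD inv_closed m_comm)
      with \<open>n g \<noteq> 0\<close> show ?thesis by (intro exI[of _ "- n g"] exI[of _ n]) simp
    qed
  qed
  with S show ?thesis
    unfolding finite_rank_def rational_basis_def using comm_group_axioms by blast
qed

lemma finite_rank_bound:
  assumes "finite_rank G" "finite S" "S \<subseteq> carrier G" "int_independent G S"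
  shows "card S \<le> abelian_rank G"
proof -
  obtain B where "comm_group G" "rational_basis G B"
    using assms(1) unfolding finite_rank_def by blast
  with assms(2-4) show ?thesis
    using comm_group.card_independent_le[of G B S] abelian_rank_eq_card[of G B]
    unfolding rational_basis_def by simp
qed

text \<open>Independence of a set that is given as the injective image of a family, with the coefficients
  indexed by the family.\<close>

lemma int_independent_reindex:
  assumes "comm_group G" "finite T" "inj_on t T" "t ` T \<subseteq> carrier G"
  shows "int_independent G (t ` T) \<longleftrightarrow>
    (\<forall>n :: 'i \<Rightarrow> int. finprod G (\<lambda>i. t i [^]\<^bsub>G\<^esub> n i) T = \<one>\<^bsub>G\<^esub> \<longrightarrow> (\<forall>i\<in>T. n i = 0))"
    (is "_ \<longleftrightarrow> ?R")
proof -
  interpret G: comm_group G by fact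
  have re: "finprod G (\<lambda>s. s [^]\<^bsub>G\<^esub> (n s :: int)) (t ` T) = finprod G (\<lambda>i. t i [^]\<^bsub>G\<^esub> n (t i)) T" for n
    using assms by (intro G.finprod_reindex) (auto simp: Pi_iff)
  show ?thesis
  proof
    assume ind: "int_independent G (t ` T)"
    show ?R
    proof (intro allI impI)
      fix n :: "'i \<Rightarrow> int" assume n: "finprod G (\<lambda>i. t i [^]\<^bsub>G\<^esub> n i) T = \<one>\<^bsub>G\<^esub>"
      let ?n = "\<lambda>s. n (inv_into T t s)"
      have "finprod G (\<lambda>i. t i [^]\<^bsub>G\<^esub> ?n (t i)) T = finprod G (\<lambda>i. t i [^]\<^bsub>G\<^esub> n i) T"
        using assms by (intro G.finprod_cong) (auto simp: Pi_iff image_subset_iff)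
      with n re[of ?n] ind have "\<forall>s\<in>t ` T. ?n s = 0" unfolding int_independent_def by metis
      then show "\<forall>i\<in>T. n i = 0" using assms(3) by auto
    qed
  next
    assume ?R
    then show "int_independent G (t ` T)" unfolding int_independent_def re by auto
  qed
qed

text \<open>A relation among lifts is mapped to a relation among the elements that are lifted.\<close>

lemma int_independent_lift:
  assumes "comm_group G" "comm_group H" "h \<in> hom G H"
    and "finite T" "t ` T \<subseteq> carrier G" "\<And>c. c \<in> T \<Longrightarrow> h (t c) = c" "int_independent H T"
  shows "int_independent G (t ` T)"
proof -
  interpret G: comm_group G by fact
  interpret H: comm_group H by fact
  interpret h: group_hom G H h using assms(3) by unfold_locales
  have [simp]: "\<And>c. c \<in> T \<Longrightarrow> t c \<in> carrier G" using assms(5) by auto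
  have inj: "inj_on t T" using assms(6) by (rule inj_on_inverseI)
  have TH: "c \<in> carrier H" if "c \<in> T" for c
    using that assms(6)[OF that] h.hom_closed[of "t c"] by simp
  have "\<forall>c\<in>T. n c = 0" if "finprod G (\<lambda>c. t c [^]\<^bsub>G\<^esub> (n c :: int)) T = \<one>\<^bsub>G\<^esub>" for n
  proof -
    have "h (finprod G (\<lambda>c. t c [^]\<^bsub>G\<^esub> n c) T) = finprod H (\<lambda>c. h (t c [^]\<^bsub>G\<^esub> n c)) T"
      using assms by (intro hom_finprod) auto
    also have "\<dots> = finprod H (\<lambda>c. c [^]\<^bsub>H\<^esub> n c) T"
      using assms TH by (intro H.finprod_cong) (auto simp: Pi_iff h.hom_int_pow)
    finally show ?thesis using that assms(7) unfolding int_independent_def by auto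
  qed
  then show ?thesis
    using int_independent_reindex[OF assms(1,4) inj assms(5)] by blast
qed

lemma int_independent_inj_image:
  assumes "comm_group G" "comm_group H" "h \<in> hom G H" "inj_on h (carrier G)"
    and "finite S" "S \<subseteq> carrier G" "int_independent G S"
  shows "int_independent H (h ` S)"
proof -
  interpret G: comm_group G by fact
  interpret H: comm_group H by fact
  interpret h: group_hom G H h using assms(3) by unfold_locales
  have [simp]: "\<And>c. c \<in> S \<Longrightarrow> c \<in> carrier G" using assms(6) by auto
  have inj: "inj_on h S" using assms(4,6) inj_on_subset by blast
  have "\<forall>c\<in>S. n c = 0" if "finprod H (\<lambda>c. h c [^]\<^bsub>H\<^esub> (n c :: int)) S = \<one>\<^bsub>H\<^esub>" for n
  proof -
    have "h (finprod G (\<lambda>c. c [^]\<^bsub>G\<^esub> n c) S) = finprod H (\<lambda>c. h (c [^]\<^bsub>G\<^esub> n c)) S"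
      using assms by (intro hom_finprod) auto
    also have "\<dots> = finprod H (\<lambda>c. h c [^]\<^bsub>H\<^esub> n c) S"
      using assms by (intro H.finprod_cong) (auto simp: Pi_iff h.hom_int_pow)
    finally have "h (finprod G (\<lambda>c. c [^]\<^bsub>G\<^esub> n c) S) = h \<one>\<^bsub>G\<^esub>" using that by simp
    then have "finprod G (\<lambda>c. c [^]\<^bsub>G\<^esub> n c) S = \<one>\<^bsub>G\<^esub>"
      using assms(4) by (subst (asm) inj_on_eq_iff) (auto simp: Pi_iff)
    then show ?thesis using assms(7) unfolding int_independent_def by auto
  qed
  then show ?thesis
    using int_independent_reindex[OF assms(2,5) inj] by (simp add: image_subset_iff)
qed

lemma finite_rank_inj:
  assumes "comm_group G" "finite_rank H" "h \<in> hom G H" "inj_on h (carrier G)"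
  shows "finite_rank G"
proof (rule comm_group.finite_rank_if_bounded[OF assms(1)])
  fix S assume S: "finite S" "S \<subseteq> carrier G" "int_independent G S"
  have H: "comm_group H" using assms(2) finite_rank_def by blast
  have "card S = card (h ` S)"
    using card_image[of h S] assms(4) S(2) inj_on_subset by metis
  also have "\<dots> \<le> abelian_rank H"
    using assms H S int_independent_inj_image[OF assms(1) H assms(3,4) S]
    by (intro finite_rank_bound) (auto simp: hom_def)
  finally show "card S \<le> abelian_rank H" .
qed

lemma finite_rank_surj:
  assumes "comm_group H" "finite_rank G" "h \<in> hom G H" "h ` carrier G = carrier H"
  shows "finite_rank H"
proof (rule comm_group.finite_rank_if_bounded[OF assms(1)])
  fix S assume S: "finite S" "S \<subseteq> carrier H" "int_independent H S"
  have G: "comm_group G" using assms(2) finite_rank_def by blast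
  let ?t = "inv_into (carrier G) h"
  have t: "?t ` S \<subseteq> carrier G" "\<And>c. c \<in> S \<Longrightarrow> h (?t c) = c"
    using S(2) assms(4) by (auto intro!: inv_into_into f_inv_into_f)
  then have "card S = card (?t ` S)"
    by (intro card_image[symmetric] inj_on_inverseI[of _ h]) auto
  also have "\<dots> \<le> abelian_rank G"
    using int_independent_lift[OF G assms(1,3) S(1) t S(3)] t(1) S(1)
    by (intro finite_rank_bound[OF assms(2)] finite_imageI)
  finally show "card S \<le> abelian_rank G" .
qed

text \<open>Additivity of rank. The image of a rational basis of \<open>A\<close> together with lifts of a rational basis of
  \<open>C\<close> is a rational basis of \<open>B\<close>: a relation is first mapped to \<open>C\<close>, which kills the coefficients of
  the lifts, and then pulled back to \<open>A\<close>; a multiple of any element differs from a combination of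
  the lifts by an element coming from \<open>A\<close>.\<close>

theorem rank_short_exact:
  assumes comm: "comm_group A" "comm_group B" "comm_group C"
    and f: "f \<in> hom A B" "inj_on f (carrier A)"
    and g: "g \<in> hom B C" "g ` carrier B = carrier C"
    and exact: "kernel B C g = f ` carrier A"
    and fin: "finite_rank A" "finite_rank C"
  shows "finite_rank B" "abelian_rank B = abelian_rank A + abelian_rank C"
proof -
  interpret A: comm_group A by fact
  interpret B: comm_group B by fact
  interpret C: comm_group C by fact
  interpret f: group_hom A B f using f(1) by unfold_locales
  interpret g: group_hom B C g using g(1) by unfold_locales
  obtain S T where "rational_basis A S" "rational_basis C T"
    using fin unfolding finite_rank_def by blast
  then have S: "finite S" "S \<subseteq> carrier A" "int_independent A S" "torsion_spans A S"
    and rank_S: "abelian_rank A = card S"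
    and T: "finite T" "T \<subseteq> carrier C" "int_independent C T" "torsion_spans C T"
    and rank_T: "abelian_rank C = card T"
    using abelian_rank_eq_card[OF comm(1)] abelian_rank_eq_card[OF comm(3)]
    unfolding rational_basis_def by blast+
  define t where "t = inv_into (carrier B) g"
  have t: "t ` T \<subseteq> carrier B" "\<And>c. c \<in> T \<Longrightarrow> g (t c) = c"
    using T(2) g(2) by (auto simp: t_def intro!: inv_into_into f_inv_into_f)
  have gf: "g (f a) = \<one>\<^bsub>C\<^esub>" if "a \<in> carrier A" for a
    using exact that unfolding kernel_def by blast
  have [simp]: "\<And>s. s \<in> S \<Longrightarrow> s \<in> carrier A" "\<And>c. c \<in> T \<Longrightarrow> c \<in> carrier C"
    "\<And>c. c \<in> T \<Longrightarrow> t c \<in> carrier B" "\<And>s. s \<in> S \<Longrightarrow> g (f s) = \<one>\<^bsub>C\<^esub>"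
    using S T t gf by auto
  have inj_f: "inj_on f S" using f(2) S(2) inj_on_subset by blast
  have inj_t: "inj_on t T" using t(2) by (rule inj_on_inverseI)
  have ind_f: "int_independent B (f ` S)"
    by (rule int_independent_inj_image[OF comm(1,2) f S(1-3)])
  \<comment> \<open>the neutral element alone is dependent; hence the two parts of the new basis are disjoint\<close>
  have "\<one>\<^bsub>C\<^esub> \<notin> T"
  proof
    assume "\<one>\<^bsub>C\<^esub> \<in> T"
    define n where "n s = (if s = \<one>\<^bsub>C\<^esub> then 1 else 0 :: int)" for s
    have "finprod C (\<lambda>s. s [^]\<^bsub>C\<^esub> n s) T = \<one>\<^bsub>C\<^esub>"
      by (intro C.finprod_one_eqI) (simp add: n_def)
    then have "\<forall>s\<in>T. n s = 0"
      using T(3) unfolding int_independent_def by blast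
    then have "\<forall>s\<in>T. s \<noteq> \<one>\<^bsub>C\<^esub>" by (auto simp: n_def)
    with \<open>\<one>\<^bsub>C\<^esub> \<in> T\<close> show False by auto
  qed
  moreover have "g u = \<one>\<^bsub>C\<^esub>" if "u \<in> f ` S" for u using that by auto
  moreover have "g u \<in> T" if "u \<in> t ` T" for u using that t(2) by auto
  ultimately have disj: "f ` S \<inter> t ` T = {}" by (metis disjoint_iff)
  let ?U = "f ` S \<union> t ` T"
  have split: "finprod B (\<lambda>u. u [^]\<^bsub>B\<^esub> (n u :: int)) ?U
      = finprod B (\<lambda>s. f s [^]\<^bsub>B\<^esub> n (f s)) S \<otimes>\<^bsub>B\<^esub> finprod B (\<lambda>c. t c [^]\<^bsub>B\<^esub> n (t c)) T" for n
  proof -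
    have "finprod B (\<lambda>u. u [^]\<^bsub>B\<^esub> n u) ?U
      = finprod B (\<lambda>u. u [^]\<^bsub>B\<^esub> n u) (f ` S) \<otimes>\<^bsub>B\<^esub> finprod B (\<lambda>u. u [^]\<^bsub>B\<^esub> n u) (t ` T)"
      using disj S(1) T(1) by (intro B.finprod_Un_disjoint) (auto simp: Pi_iff)
    also have "finprod B (\<lambda>u. u [^]\<^bsub>B\<^esub> n u) (f ` S) = finprod B (\<lambda>s. f s [^]\<^bsub>B\<^esub> n (f s)) S"
      using inj_f by (intro B.finprod_reindex) (auto simp: Pi_iff)
    also have "finprod B (\<lambda>u. u [^]\<^bsub>B\<^esub> n u) (t ` T) = finprod B (\<lambda>c. t c [^]\<^bsub>B\<^esub> n (t c)) T"
      using inj_t by (intro B.finprod_reindex) (auto simp: Pi_iff)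
    finally show ?thesis .
  qed
  have gS: "g (finprod B (\<lambda>s. f s [^]\<^bsub>B\<^esub> (n s :: int)) S) = \<one>\<^bsub>C\<^esub>" for n
  proof -
    have "g (finprod B (\<lambda>s. f s [^]\<^bsub>B\<^esub> n s) S) = finprod C (\<lambda>s. g (f s [^]\<^bsub>B\<^esub> n s)) S"
      using comm g by (intro hom_finprod) auto
    also have "\<dots> = \<one>\<^bsub>C\<^esub>"
      by (intro C.finprod_one_eqI) (simp add: g.hom_int_pow)
    finally show ?thesis .
  qed
  have gT: "g (finprod B (\<lambda>c. t c [^]\<^bsub>B\<^esub> (n c :: int)) T) = finprod C (\<lambda>c. c [^]\<^bsub>C\<^esub> n c) T" for n
  proof -
    have "g (finprod B (\<lambda>c. t c [^]\<^bsub>B\<^esub> n c) T) = finprod C (\<lambda>c. g (t c [^]\<^bsub>B\<^esub> n c)) T"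
      using comm g by (intro hom_finprod) auto
    also have "\<dots> = finprod C (\<lambda>c. c [^]\<^bsub>C\<^esub> n c) T"
      using t(2) by (intro C.finprod_cong) (auto simp: Pi_iff g.hom_int_pow)
    finally show ?thesis .
  qed
  have "int_independent B ?U"
    unfolding int_independent_def
  proof (intro allI impI)
    fix n :: "_ \<Rightarrow> int" assume "finprod B (\<lambda>u. u [^]\<^bsub>B\<^esub> n u) ?U = \<one>\<^bsub>B\<^esub>"
    then have eq: "finprod B (\<lambda>s. f s [^]\<^bsub>B\<^esub> n (f s)) S \<otimes>\<^bsub>B\<^esub> finprod B (\<lambda>c. t c [^]\<^bsub>B\<^esub> n (t c)) T = \<one>\<^bsub>B\<^esub>"
      by (simp add: split)
    then have "g (finprod B (\<lambda>s. f s [^]\<^bsub>B\<^esub> n (f s)) S) \<otimes>\<^bsub>C\<^esub> g (finprod B (\<lambda>c. t c [^]\<^bsub>B\<^esub> n (t c)) T) = \<one>\<^bsub>C\<^esub>"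
      by (subst g.hom_mult[symmetric]) (auto simp: Pi_iff)
    then have "finprod C (\<lambda>c. c [^]\<^bsub>C\<^esub> n (t c)) T = \<one>\<^bsub>C\<^esub>"
      by (simp add: gS gT Pi_iff)
    then have nT: "\<forall>c\<in>T. n (t c) = 0"
      by (rule int_independentD[OF T(3)])
    then have "finprod B (\<lambda>c. t c [^]\<^bsub>B\<^esub> n (t c)) T = \<one>\<^bsub>B\<^esub>"
      by (intro B.finprod_one_eqI) simp
    with eq have "finprod B (\<lambda>s. f s [^]\<^bsub>B\<^esub> n (f s)) S = \<one>\<^bsub>B\<^esub>"
      by (simp add: Pi_iff)
    then have "\<forall>s\<in>S. n (f s) = 0"
      using ind_f int_independent_reindex[OF comm(2) S(1) inj_f] by (auto simp: image_subset_iff)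
    with nT show "\<forall>u\<in>?U. n u = 0" by auto
  qed
  moreover have "torsion_spans B ?U"
    unfolding torsion_spans_def
  proof
    fix x assume x: "x \<in> carrier B"
    then obtain n :: int and a :: "_ \<Rightarrow> int"
      where n: "n \<noteq> 0" "g x [^]\<^bsub>C\<^esub> n = finprod C (\<lambda>c. c [^]\<^bsub>C\<^esub> a c) T"
      using T(4) unfolding torsion_spans_def by (meson g.hom_closed)
    define y where "y = finprod B (\<lambda>c. t c [^]\<^bsub>B\<^esub> a c) T"
    have y: "y \<in> carrier B" by (auto simp: y_def Pi_iff)
    have "g (x [^]\<^bsub>B\<^esub> n \<otimes>\<^bsub>B\<^esub> inv\<^bsub>B\<^esub> y) = \<one>\<^bsub>C\<^esub>"
      using x y n(2) gT[of a] by (simp add: g.hom_int_pow y_def[symmetric])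
    then have "x [^]\<^bsub>B\<^esub> n \<otimes>\<^bsub>B\<^esub> inv\<^bsub>B\<^esub> y \<in> f ` carrier A"
      using exact x y unfolding kernel_def by auto
    then obtain z where z: "z \<in> carrier A" "x [^]\<^bsub>B\<^esub> n \<otimes>\<^bsub>B\<^esub> inv\<^bsub>B\<^esub> y = f z" by auto
    then have xn: "x [^]\<^bsub>B\<^esub> n = f z \<otimes>\<^bsub>B\<^esub> y"
      using x y by (metis B.inv_closed B.inv_solve_right' B.int_pow_closed f.hom_closed B.inv_inv)
    obtain m :: int and b :: "_ \<Rightarrow> int"
      where m: "m \<noteq> 0" "z [^]\<^bsub>A\<^esub> m = finprod A (\<lambda>s. s [^]\<^bsub>A\<^esub> b s) S"
      using S(4) z unfolding torsion_spans_def by meson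
    \<comment> \<open>as \<open>g (t c) = c\<close>, the coefficient of the lift of \<open>c\<close> can be read off through \<open>g\<close>\<close>
    define e where "e u = (if u \<in> f ` S then b (inv_into S f u) else m * a (g u))" for u
    have "x [^]\<^bsub>B\<^esub> (n * m) = (f z \<otimes>\<^bsub>B\<^esub> y) [^]\<^bsub>B\<^esub> m"
      using x xn by (metis B.int_pow_pow)
    also have "\<dots> = f z [^]\<^bsub>B\<^esub> m \<otimes>\<^bsub>B\<^esub> y [^]\<^bsub>B\<^esub> m"
      using z y by (simp add: B.int_pow_distrib)
    also have "f z [^]\<^bsub>B\<^esub> m = finprod B (\<lambda>s. f (s [^]\<^bsub>A\<^esub> b s)) S"
      using z m(2) comm f by (simp flip: f.hom_int_pow add: hom_finprod)
    also have "\<dots> = finprod B (\<lambda>s. f s [^]\<^bsub>B\<^esub> e (f s)) S"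
      using inj_f by (intro B.finprod_cong) (auto simp: Pi_iff e_def f.hom_int_pow)
    also have "y [^]\<^bsub>B\<^esub> m = finprod B (\<lambda>c. (t c [^]\<^bsub>B\<^esub> a c) [^]\<^bsub>B\<^esub> m) T"
      unfolding y_def by (intro B.finprod_int_pow) auto
    also have "\<dots> = finprod B (\<lambda>c. t c [^]\<^bsub>B\<^esub> e (t c)) T"
    proof (intro B.finprod_cong')
      show "(t c [^]\<^bsub>B\<^esub> a c) [^]\<^bsub>B\<^esub> m = t c [^]\<^bsub>B\<^esub> e (t c)" if "c \<in> T" for c
      proof -
        have "t c \<notin> f ` S" using that disj by auto
        then have "e (t c) = m * a c" using that t(2) by (simp add: e_def)
        then show ?thesis using that by (simp add: B.int_pow_pow mult.commute)
      qed
    qed auto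
    also have "finprod B (\<lambda>s. f s [^]\<^bsub>B\<^esub> e (f s)) S \<otimes>\<^bsub>B\<^esub> finprod B (\<lambda>c. t c [^]\<^bsub>B\<^esub> e (t c)) T
        = finprod B (\<lambda>u. u [^]\<^bsub>B\<^esub> e u) ?U"
      by (rule split[symmetric])
    finally show "\<exists>(n::int) c. n \<noteq> 0 \<and> x [^]\<^bsub>B\<^esub> n = finprod B (\<lambda>b. b [^]\<^bsub>B\<^esub> (c b :: int)) ?U"
      using n(1) m(1) by (intro exI[of _ "n * m"] exI[of _ e]) auto
  qed
  ultimately have basis: "rational_basis B ?U"
    using S(1) T(1) unfolding rational_basis_def by auto
  then show "finite_rank B" unfolding finite_rank_def using comm by blast
  have "abelian_rank B = card ?U" using basis comm by (simp add: abelian_rank_eq_card)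
  also have "\<dots> = card S + card T"
    using disj S(1) T(1) inj_f inj_t by (simp add: card_Un_disjoint card_image)
  finally show "abelian_rank B = abelian_rank A + abelian_rank C" by (simp add: rank_S rank_T)
qed


lemma finite_rank_subgroup:
  assumes "finite_rank G"
  shows "finite_rank (subgroup_generated G S)"
proof -
  have G: "comm_group G" using assms finite_rank_def by blast
  then interpret comm_group G .
  show ?thesis
    using carrier_subgroup_generated_subset[of S] abelian_subgroup_generated[OF G]
    by (intro finite_rank_inj[OF _ assms, of _ id]) (auto simp: hom_def)
qed

lemma trivial_rank:
  assumes "comm_group G" "carrier G \<subseteq> {\<one>\<^bsub>G\<^esub>}"
  shows "finite_rank G" "abelian_rank G = 0"
proof -
  interpret comm_group G by fact
  have "rational_basis G {}"
    using assms(2) unfolding rational_basis_def torsion_spans_def int_independent_def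
    by (auto intro!: exI[of _ "1 :: int"])
  then show "finite_rank G" "abelian_rank G = 0"
    using assms(1) abelian_rank_eq_card[of G] unfolding finite_rank_def by auto
qed

section \<open>Cohomology of a three-term complex\<close>

locale three_term_complex = A: comm_group A + B: comm_group B + C: comm_group C
  for A :: "('a, 'p) monoid_scheme" and B :: "('b, 'q) monoid_scheme"
    and C :: "('c, 'r) monoid_scheme" +
  fixes f :: "'a \<Rightarrow> 'b" and g :: "'b \<Rightarrow> 'c"
  assumes f_hom: "f \<in> hom A B" and g_hom: "g \<in> hom B C"
    and complex: "\<And>a. a \<in> carrier A \<Longrightarrow> g (f a) = \<one>\<^bsub>C\<^esub>"
begin

abbreviation cocycles where "cocycles \<equiv> subgroup_generated B (kernel B C g)"
abbreviation coboundaries where "coboundaries \<equiv> subgroup_generated B (f ` carrier A)"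

sublocale f: group_hom A B f using f_hom by unfold_locales
sublocale g: group_hom B C g using g_hom by unfold_locales

lemma carrier_cocycles: "carrier cocycles = kernel B C g"
  using g.subgroup_kernel by (rule subgroup.carrier_subgroup_generated_subgroup)

lemma carrier_coboundaries: "carrier coboundaries = f ` carrier A"
  using f.img_is_subgroup by (rule subgroup.carrier_subgroup_generated_subgroup)

lemma comm_group_cocycles: "comm_group cocycles"
  by (rule B.abelian_subgroup_generated) (rule B.comm_group_axioms)

lemma subgroup_coboundaries: "subgroup (f ` carrier A) cocycles"
  using f.img_is_subgroup complex carrier_cocycles
  by (auto simp: B.subgroup_subgroup_generated_iff kernel_def)

sublocale cocycles: comm_group cocycles by (rule comm_group_cocycles)

sublocale coboundaries: normal "f ` carrier A" cocycles
  using subgroup_coboundaries by (rule cocycles.subgroup_imp_normal)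

lemma comm_group_cohomology: "comm_group (cohomology_at A B C f g)"
  unfolding cohomology_at_def
  using subgroup_coboundaries by (rule cocycles.abelian_FactGroup)

lemma r_coset_cocycles: "r_coset cocycles = r_coset B"
  by (simp add: fun_eq_iff r_coset_def)

lemma coset_hom: "(\<lambda>c. f ` carrier A #>\<^bsub>B\<^esub> c) \<in> hom cocycles (cohomology_at A B C f g)"
  unfolding cohomology_at_def using coboundaries.r_coset_hom_Mod by (simp add: r_coset_cocycles)

lemma carrier_cohomology:
  "carrier (cohomology_at A B C f g) = (\<lambda>c. f ` carrier A #>\<^bsub>B\<^esub> c) ` kernel B C g"
  by (simp add: cohomology_at_def carrier_FactGroup r_coset_cocycles carrier_cocycles)

lemma one_cohomology: "\<one>\<^bsub>cohomology_at A B C f g\<^esub> = f ` carrier A"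
  by (simp add: cohomology_at_def)

lemma finite_rank_cohomology:
  assumes "finite_rank B"
  shows "finite_rank (cohomology_at A B C f g)"
  using carrier_cohomology carrier_cocycles
  by (intro finite_rank_surj[OF comm_group_cohomology finite_rank_subgroup[OF assms] coset_hom]) simp

text \<open>The middle group is an extension of the image of \<open>g\<close> by the cocycles, and these are an extension
  of the cohomology by the coboundaries. Summed with alternating signs along a complex, the ranks of
  the images cancel in pairs.\<close>

lemma rank_cohomology:
  assumes fin: "finite_rank B"
  shows "abelian_rank B = abelian_rank (cohomology_at A B C f g)
     + abelian_rank coboundaries + abelian_rank (subgroup_generated C (g ` carrier B))"
proof -
  let ?H = "cohomology_at A B C f g" and ?D = "subgroup_generated C (g ` carrier B)"
  have D: "comm_group ?D" "carrier ?D = g ` carrier B"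
    using C.abelian_subgroup_generated[OF C.comm_group_axioms] g.img_is_subgroup
    by (auto simp: subgroup.carrier_subgroup_generated_subgroup)
  have gD: "g \<in> hom B ?D"
    using g_hom D(2) by (auto simp: hom_def)
  have cob: "comm_group coboundaries"
    by (rule B.abelian_subgroup_generated) (rule B.comm_group_axioms)
  have "abelian_rank B = abelian_rank cocycles + abelian_rank ?D"
  proof (rule rank_short_exact(2)[where f = id and g = g])
    show "finite_rank ?D" using D fin gD by (intro finite_rank_surj[of _ B g]) auto
    show "id \<in> hom cocycles B" using carrier_cocycles by (auto simp: hom_def kernel_def)
    show "kernel B ?D g = id ` carrier cocycles" by (simp add: carrier_cocycles)
  qed (use D gD fin in \<open>auto intro: comm_group_cocycles finite_rank_subgroup B.comm_group_axioms\<close>)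
  also have "abelian_rank cocycles = abelian_rank coboundaries + abelian_rank ?H"
  proof (rule rank_short_exact(2)[where f = id and g = "\<lambda>c. f ` carrier A #>\<^bsub>B\<^esub> c"])
    show "id \<in> hom coboundaries cocycles"
      using subgroup.subset[OF subgroup_coboundaries] by (auto simp: hom_def carrier_coboundaries)
    show "kernel cocycles ?H ((#>\<^bsub>B\<^esub>) (f ` carrier A)) = id ` carrier coboundaries"
    proof -
      have "f ` carrier A #>\<^bsub>B\<^esub> c = f ` carrier A \<longleftrightarrow> c \<in> f ` carrier A" if "c \<in> carrier cocycles" for c
        using that cocycles.coset_join1[OF _ _ subgroup_coboundaries] cocycles.coset_join2[OF _ subgroup_coboundaries]
          subgroup.subset[OF subgroup_coboundaries]
        by (metis r_coset_cocycles)
      then have "kernel cocycles ?H ((#>\<^bsub>B\<^esub>) (f ` carrier A)) = {c \<in> carrier cocycles. c \<in> f ` carrier A}"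
        unfolding kernel_def[of cocycles] one_cohomology by blast
      then show ?thesis
        using subgroup.subset[OF subgroup_coboundaries] unfolding carrier_coboundaries by auto
    qed
  qed (use fin in \<open>auto intro: comm_group_cocycles comm_group_cohomology cob coset_hom finite_rank_subgroup
      finite_rank_cohomology simp: carrier_cohomology carrier_cocycles\<close>)
  finally show ?thesis by simp
qed

end

section \<open>Orientation signs\<close>

lemma eps_remove_smaller:
  assumes "finite J" "i \<in> J" "i < j"
  shows "eps j (J - {i}) = - eps j J"
proof -
  have "{r \<in> J. r < j} = insert i {r \<in> J - {i}. r < j}" using assms by auto
  then have "card {r \<in> J. r < j} = Suc (card {r \<in> J - {i}. r < j})" using assms by simp
  then show ?thesis by (simp add: eps_def)
qed

lemma eps_remove_larger:
  assumes "i < j"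
  shows "eps i (J - {j}) = eps i J"
proof -
  have "{r \<in> J - {j}. r < i} = {r \<in> J. r < i}" using assms by auto
  then show ?thesis by (simp add: eps_def)
qed

text \<open>Removing two vertices in either order gives opposite signs. This single rule makes both the
  coboundary and \<open>d'\<close> square to zero.\<close>

lemma eps_anticommute:
  assumes "finite J" "i \<in> J" "j \<in> J" "i \<noteq> j"
  shows "eps j J * eps i (J - {j}) = - (eps i J * eps j (J - {i}))"
proof (cases "i < j")
  case True
  then show ?thesis
    using assms eps_remove_smaller[of J i j] eps_remove_larger[of i j J] by simp
next
  case False
  then show ?thesis
    using assms eps_remove_smaller[of J j i] eps_remove_larger[of j i J] by simp
qed

lemma sum_antisymmetric:
  fixes t :: "'i \<Rightarrow> 'i \<Rightarrow> int"
  assumes "finite V" "\<And>i j. i \<in> V \<Longrightarrow> j \<in> V \<Longrightarrow> i \<noteq> j \<Longrightarrow> t j i = - t i j"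
  shows "(\<Sum>i\<in>V. \<Sum>j\<in>V - {i}. t i j) = 0"
proof -
  define u where "u i j = (if i = j then 0 else t i j)" for i j
  have eq: "(\<Sum>i\<in>V. \<Sum>j\<in>V - {i}. t i j) = (\<Sum>i\<in>V. \<Sum>j\<in>V. u i j)"
    using assms(1) by (intro sum.cong refl sum.mono_neutral_cong_left) (auto simp: u_def)
  have "(\<Sum>i\<in>V. \<Sum>j\<in>V. u i j) = (\<Sum>j\<in>V. \<Sum>i\<in>V. u i j)" by (rule sum.swap)
  also have "\<dots> = (\<Sum>j\<in>V. \<Sum>i\<in>V. - u j i)"
  proof (intro sum.cong refl)
    show "u i j = - u j i" if "j \<in> V" "i \<in> V" for i j
      using assms(2)[of j i] that by (cases "i = j") (simp_all add: u_def)
  qed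
  also have "\<dots> = - (\<Sum>i\<in>V. \<Sum>j\<in>V. u i j)" by (simp add: sum_negf)
  finally show ?thesis using eq by simp
qed

text \<open>The counterpart of \<open>sum_antisymmetric\<close> in an arbitrary abelian group. There an element equal to its
  own inverse need not be trivial, so exchanging the order of the products does not suffice, and the
  factors are cancelled in pairs by induction.\<close>

lemma (in comm_group) finprod_antisymmetric:
  assumes "finite V" "\<And>i j. i \<in> V \<Longrightarrow> j \<in> V \<Longrightarrow> i \<noteq> j \<Longrightarrow> t i j \<in> carrier G"
    "\<And>i j. i \<in> V \<Longrightarrow> j \<in> V \<Longrightarrow> i \<noteq> j \<Longrightarrow> t i j \<otimes> t j i = \<one>"
  shows "finprod G (\<lambda>i. finprod G (t i) (V - {i})) V = \<one>"
  using assms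
proof (induction V rule: finite_induct)
  case (insert v V)
  have V: "insert v V - {i} = insert v (V - {i})" if "i \<in> V" for i using that insert by auto
  have v: "insert v V - {v} = V" using insert by auto
  have tv [simp]: "t v i \<in> carrier G" "t i v \<in> carrier G" if "i \<in> V" for i
    using that insert.prems(1) insert.hyps by auto
  have tt [simp]: "t i j \<in> carrier G" if "i \<in> V" "j \<in> V" "j \<noteq> i" for i j
    using that insert.prems(1) by auto
  have "finprod G (\<lambda>i. finprod G (t i) (insert v V - {i})) (insert v V)
      = finprod G (t v) V \<otimes> finprod G (\<lambda>i. finprod G (t i) (insert v V - {i})) V"
    using insert.hyps v by (subst finprod_insert) (auto simp: Pi_iff V)
  also have "finprod G (\<lambda>i. finprod G (t i) (insert v V - {i})) V
      = finprod G (\<lambda>i. t i v \<otimes> finprod G (t i) (V - {i})) V"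
    using insert.hyps by (intro finprod_cong') (auto simp: Pi_iff V)
  also have "\<dots> = finprod G (\<lambda>i. t i v) V \<otimes> finprod G (\<lambda>i. finprod G (t i) (V - {i})) V"
    by (intro finprod_multf) (auto simp: Pi_iff)
  also have "finprod G (\<lambda>i. finprod G (t i) (V - {i})) V = \<one>"
    using insert.prems by (intro insert.IH) auto
  also have "finprod G (t v) V \<otimes> (finprod G (\<lambda>i. t i v) V \<otimes> \<one>) = finprod G (\<lambda>i. t v i \<otimes> t i v) V"
    by (simp add: Pi_iff)
  also have "\<dots> = \<one>"
    using insert.prems(2) insert.hyps by (intro finprod_one_eqI) auto
  finally show ?case .
qed simp

section \<open>Cochains and reduced cohomology\<close>

lemma carrier_cochain_group:
  "c \<in> carrier (cochain_group L p) \<longleftrightarrow> (\<forall>J. J \<notin> simplices L p \<longrightarrow> c J = 0)"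
  by (simp add: cochain_group_def)

lemma mult_cochain_group [simp]: "a \<otimes>\<^bsub>cochain_group L p\<^esub> b = (\<lambda>J. a J + b J)"
  by (simp add: cochain_group_def)

lemma one_cochain_group [simp]: "\<one>\<^bsub>cochain_group L p\<^esub> = (\<lambda>J. 0)"
  by (simp add: cochain_group_def)

lemma comm_group_cochain_group: "comm_group (cochain_group L p)"
proof (rule comm_groupI)
  show "\<exists>y\<in>carrier (cochain_group L p). y \<otimes>\<^bsub>cochain_group L p\<^esub> x = \<one>\<^bsub>cochain_group L p\<^esub>"
    if "x \<in> carrier (cochain_group L p)" for x
    using that by (intro bexI[of _ "\<lambda>J. - x J"]) (auto simp: carrier_cochain_group)
qed (auto simp: carrier_cochain_group fun_eq_iff)

global_interpretation cochain: comm_group "cochain_group L p" for L p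
  by (rule comm_group_cochain_group)

lemma inv_cochain_group:
  "c \<in> carrier (cochain_group L p) \<Longrightarrow> inv\<^bsub>cochain_group L p\<^esub> c = (\<lambda>J. - c J)"
  by (rule cochain.inv_equality) (auto simp: carrier_cochain_group)

lemma int_pow_cochain_group:
  assumes "c \<in> carrier (cochain_group L p)"
  shows "(c [^]\<^bsub>cochain_group L p\<^esub> (n::int)) J = n * c J"
proof -
  have nat: "(c [^]\<^bsub>cochain_group L p\<^esub> (k::nat)) J = int k * c J" for k
    by (induction k) (auto simp: algebra_simps)
  show ?thesis
  proof (cases n rule: int_cases2)
    case (nonneg k)
    then show ?thesis by (simp add: nat int_pow_int)
  next
    case (nonpos k)
    then show ?thesis
      using assms by (simp add: cochain.int_pow_neg_int inv_cochain_group nat)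
  qed
qed

lemma finprod_cochain_group:
  assumes "\<And>a. a \<in> A \<Longrightarrow> f a \<in> carrier (cochain_group L p)"
  shows "finprod (cochain_group L p) f A J = (\<Sum>a\<in>A. f a J)"
  using assms by (induction A rule: infinite_finite_induct) (auto simp: Pi_iff)

text \<open>The indicator functions of the simplices form a basis.\<close>

lemma rank_cochain_group:
  assumes "finite (simplices L p)"
  shows "finite_rank (cochain_group L p)" "abelian_rank (cochain_group L p) = card (simplices L p)"
proof -
  let ?S = "simplices L p" and ?G = "cochain_group L p"
  define d where "d J = (\<lambda>J'. if J' = J then 1 else 0 :: int)" for J :: "nat set"
  have d: "d J \<in> carrier ?G" if "J \<in> ?S" for J
    using that by (auto simp: carrier_cochain_group d_def)
  have inj: "inj_on d ?S"
    by (rule inj_onI) (metis d_def zero_neq_one)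
  have comb: "finprod ?G (\<lambda>J. d J [^]\<^bsub>?G\<^esub> (n J :: int)) ?S J' = (if J' \<in> ?S then n J' else 0)" for n J'
    using assms d by (subst finprod_cochain_group)
      (auto simp: int_pow_cochain_group d_def if_distrib cong: if_cong)
  have "int_independent ?G (d ` ?S)"
  proof (subst int_independent_reindex[OF comm_group_cochain_group assms inj])
    show "d ` ?S \<subseteq> carrier ?G" using d by blast
    show "\<forall>n :: nat set \<Rightarrow> int. finprod ?G (\<lambda>J. d J [^]\<^bsub>?G\<^esub> n J) ?S = \<one>\<^bsub>?G\<^esub> \<longrightarrow> (\<forall>J\<in>?S. n J = 0)"
    proof (intro allI impI ballI)
      fix n :: "nat set \<Rightarrow> int" and J
      assume "finprod ?G (\<lambda>J. d J [^]\<^bsub>?G\<^esub> n J) ?S = \<one>\<^bsub>?G\<^esub>" "J \<in> ?S"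
      then show "n J = 0" using comb[of n J] by simp
    qed
  qed
  moreover have "torsion_spans ?G (d ` ?S)"
    unfolding torsion_spans_def
  proof
    fix c assume c: "c \<in> carrier ?G"
    define n where "n b = c (inv_into ?S d b)" for b
    have "finprod ?G (\<lambda>b. b [^]\<^bsub>?G\<^esub> n b) (d ` ?S) = finprod ?G (\<lambda>J. d J [^]\<^bsub>?G\<^esub> n (d J)) ?S"
      using inj d by (intro cochain.finprod_reindex) (auto simp: Pi_iff)
    also have "\<dots> = c"
      using inj c by (auto simp: fun_eq_iff comb n_def carrier_cochain_group)
    finally show "\<exists>(n::int) k. n \<noteq> 0 \<and> c [^]\<^bsub>?G\<^esub> n = finprod ?G (\<lambda>b. b [^]\<^bsub>?G\<^esub> (k b :: int)) (d ` ?S)"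
      using c by (intro exI[of _ 1] exI[of _ n]) simp
  qed
  ultimately have basis: "rational_basis ?G (d ` ?S)"
    unfolding rational_basis_def using assms d by blast
  then show "finite_rank ?G" unfolding finite_rank_def using comm_group_cochain_group by blast
  show "abelian_rank ?G = card ?S"
    using abelian_rank_eq_card[OF comm_group_cochain_group basis] inj by (simp add: card_image)
qed

lemma coboundary_hom:
  "coboundary L p \<in> hom (cochain_group L p) (cochain_group L (p + 1))"
  by (auto simp: hom_def carrier_cochain_group coboundary_def fun_eq_iff algebra_simps sum.distrib)

definition down_closed :: "nat set set \<Rightarrow> bool" where
  "down_closed L \<longleftrightarrow> (\<forall>J\<in>L. \<forall>J'. J' \<subseteq> J \<longrightarrow> J' \<in> L)"

lemma simplices_facet:
  assumes "down_closed L" "J \<in> simplices L (p + 1)" "j \<in> J"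
  shows "J - {j} \<in> simplices L p"
proof -
  have "card J = Suc (card (J - {j}))"
    using assms by (intro card.remove) (auto simp: simplices_def)
  moreover have "J - {j} \<in> L" using assms by (auto simp: simplices_def down_closed_def)
  ultimately show ?thesis using assms(2) by (auto simp: simplices_def)
qed

lemma coboundary_coboundary:
  assumes "down_closed L"
  shows "coboundary L (p + 1) (coboundary L p c) = (\<lambda>J. 0)"
proof
  fix J
  show "coboundary L (p + 1) (coboundary L p c) J = 0"
  proof (cases "J \<in> simplices L (p + 1 + 1)")
    case True
    then have fin: "finite J" by (simp add: simplices_def)
    have "coboundary L (p + 1) (coboundary L p c) J
        = (\<Sum>j\<in>J. eps j J * (\<Sum>i\<in>J - {j}. eps i (J - {j}) * c (J - {j} - {i})))"
      using True simplices_facet[OF assms True] by (simp add: coboundary_def)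
    also have "\<dots> = (\<Sum>j\<in>J. \<Sum>i\<in>J - {j}. eps j J * eps i (J - {j}) * c (J - {i, j}))"
    proof (intro sum.cong refl)
      have "J - {j} - {i} = J - {i, j}" for i j by auto
      then show "eps j J * (\<Sum>i\<in>J - {j}. eps i (J - {j}) * c (J - {j} - {i}))
          = (\<Sum>i\<in>J - {j}. eps j J * eps i (J - {j}) * c (J - {i, j}))" for j
        by (simp add: sum_distrib_left mult.assoc)
    qed
    also have "\<dots> = 0"
    proof (rule sum_antisymmetric[OF fin])
      fix i j assume ij: "i \<in> J" "j \<in> J" "i \<noteq> j"
      have "J - {j, i} = J - {i, j}" by auto
      then have "c (J - {j, i}) = c (J - {i, j})" by (rule arg_cong)
      then show "eps j J * eps i (J - {j}) * c (J - {i, j}) = - (eps i J * eps j (J - {i}) * c (J - {j, i}))"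
        using eps_anticommute[OF fin ij] by simp
    qed
    finally show ?thesis .
  qed (simp add: coboundary_def)
qed

lemma cochain_complex:
  assumes "down_closed L"
  shows "three_term_complex (cochain_group L (p - 1)) (cochain_group L p) (cochain_group L (p + 1))
    (coboundary L (p - 1)) (coboundary L p)"
proof unfold_locales
  show "coboundary L (p - 1) \<in> hom (cochain_group L (p - 1)) (cochain_group L p)"
    using coboundary_hom[of L "p - 1"] by simp
  show "coboundary L p (coboundary L (p - 1) a) = \<one>\<^bsub>cochain_group L (p + 1)\<^esub>" for a
    using coboundary_coboundary[OF assms, of "p - 1"] by simp
qed (rule coboundary_hom)

abbreviation coboundary_group :: "nat set set \<Rightarrow> int \<Rightarrow> (nat set \<Rightarrow> int) set" where
  "coboundary_group L p \<equiv> coboundary L (p - 1) ` carrier (cochain_group L (p - 1))"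

abbreviation cocycle_group :: "nat set set \<Rightarrow> int \<Rightarrow> (nat set \<Rightarrow> int) set" where
  "cocycle_group L p \<equiv> kernel (cochain_group L p) (cochain_group L (p + 1)) (coboundary L p)"

lemma comm_group_red_cohomology:
  "down_closed L \<Longrightarrow> comm_group (red_cohomology L p)"
  unfolding red_cohomology_def by (rule three_term_complex.comm_group_cohomology[OF cochain_complex])

lemma finite_rank_red_cohomology:
  "down_closed L \<Longrightarrow> finite (simplices L p) \<Longrightarrow> finite_rank (red_cohomology L p)"
  unfolding red_cohomology_def
  by (intro three_term_complex.finite_rank_cohomology[OF cochain_complex] rank_cochain_group)

lemma rank_red_cohomology:
  assumes "down_closed L" "finite (simplices L p)"
  shows "card (simplices L p) = abelian_rank (red_cohomology L p)
    + abelian_rank (subgroup_generated (cochain_group L p) (coboundary_group L p))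
    + abelian_rank (subgroup_generated (cochain_group L (p + 1)) (coboundary_group L (p + 1)))"
  using three_term_complex.rank_cohomology[OF cochain_complex[OF assms(1)] rank_cochain_group(1)[OF assms(2)]]
    rank_cochain_group(2)[OF assms(2)]
  by (simp add: red_cohomology_def)

lemma carrier_red_cohomology:
  "down_closed L \<Longrightarrow> carrier (red_cohomology L p) =
     (\<lambda>c. coboundary_group L p #>\<^bsub>cochain_group L p\<^esub> c) ` cocycle_group L p"
  unfolding red_cohomology_def by (rule three_term_complex.carrier_cohomology[OF cochain_complex])

lemma restrict_cochain_coboundary:
  assumes "down_closed L" "L \<subseteq> L'"
  shows "restrict_cochain L (p + 1) (coboundary L' p c) = coboundary L p (restrict_cochain L p c)"
proof
  fix J
  show "restrict_cochain L (p + 1) (coboundary L' p c) J = coboundary L p (restrict_cochain L p c) J"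
    using simplices_facet[OF assms(1), of J p] assms(2)
    by (auto simp: restrict_cochain_def coboundary_def simplices_def intro!: sum.cong)
qed

lemma restrict_cochain_add:
  "restrict_cochain L p (\<lambda>J. a J + b J) = (\<lambda>J. restrict_cochain L p a J + restrict_cochain L p b J)"
  by (auto simp: restrict_cochain_def)

lemma restrict_cochain_carrier: "restrict_cochain L p c \<in> carrier (cochain_group L p)"
  by (simp add: restrict_cochain_def carrier_cochain_group)

lemma restrict_cochain_cocycle:
  assumes "down_closed L" "L \<subseteq> L'" "c \<in> cocycle_group L' p"
  shows "restrict_cochain L p c \<in> cocycle_group L p"
  using assms restrict_cochain_coboundary[OF assms(1,2), of p c]
  by (auto simp: kernel_def restrict_cochain_carrier) (auto simp: restrict_cochain_def)

lemma restrict_cochain_restrict: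
  "L \<subseteq> L' \<Longrightarrow> restrict_cochain L p (restrict_cochain L' p c) = restrict_cochain L p c"
  by (auto simp: restrict_cochain_def simplices_def fun_eq_iff)

text \<open>Restriction commutes with the coboundary, so the restrictions of cohomologous cocycles are
  cohomologous. Hence all cosets in the union that defines the induced map coincide.\<close>

lemma red_cohomology_restrict_class:
  assumes "down_closed L" "L \<subseteq> L'" "c \<in> cocycle_group L' p"
  shows "red_cohomology_restrict L p (coboundary_group L' p #>\<^bsub>cochain_group L' p\<^esub> c)
    = coboundary_group L p #>\<^bsub>cochain_group L p\<^esub> restrict_cochain L p c"
proof -
  interpret L: three_term_complex "cochain_group L (p - 1)" "cochain_group L p" "cochain_group L (p + 1)"
    "coboundary L (p - 1)" "coboundary L p" by (rule cochain_complex) fact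
  let ?G = "cochain_group L p" and ?B = "coboundary_group L p"
  have coset: "?B #>\<^bsub>?G\<^esub> restrict_cochain L p x = ?B #>\<^bsub>?G\<^esub> restrict_cochain L p c"
    if "x \<in> coboundary_group L' p #>\<^bsub>cochain_group L' p\<^esub> c" for x
  proof -
    from that obtain b where x: "x = (\<lambda>J. coboundary L' (p - 1) b J + c J)"
      by (auto simp: r_coset_def)
    have "restrict_cochain L p x
        = (\<lambda>J. coboundary L (p - 1) (restrict_cochain L (p - 1) b) J + restrict_cochain L p c J)"
      using restrict_cochain_coboundary[OF assms(1,2), of "p - 1" b]
      by (simp add: x restrict_cochain_add)
    then have "restrict_cochain L p x \<in> ?B #>\<^bsub>?G\<^esub> restrict_cochain L p c"
      using restrict_cochain_carrier[of L "p - 1" b] by (auto simp: r_coset_def)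
    then show ?thesis
      using cochain.repr_independence[OF _ restrict_cochain_carrier L.f.img_is_subgroup] by metis
  qed
  have "(\<lambda>J. 0) \<in> coboundary_group L' p"
    by (rule image_eqI[of _ _ "\<lambda>J. 0"]) (auto simp: coboundary_def carrier_cochain_group)
  then have "c \<in> coboundary_group L' p #>\<^bsub>cochain_group L' p\<^esub> c"
    unfolding r_coset_def by (intro UN_I[of "\<lambda>J. 0"]) auto
  with coset show ?thesis
    unfolding red_cohomology_restrict_def by blast
qed

lemma red_cohomology_restrict_hom:
  assumes "down_closed L" "down_closed L'" "L \<subseteq> L'"
  shows "red_cohomology_restrict L p \<in> hom (red_cohomology L' p) (red_cohomology L p)"
proof -
  let ?cls = "\<lambda>L. r_coset (cochain_group L p) (coboundary_group L p)"
  have cls: "?cls L (\<lambda>J. a J + b J) = ?cls L a \<otimes>\<^bsub>red_cohomology L p\<^esub> ?cls L b"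
    if "down_closed L" "a \<in> cocycle_group L p" "b \<in> cocycle_group L p" for L a b
    using three_term_complex.coset_hom[OF cochain_complex[OF that(1)], of p]
      three_term_complex.carrier_cocycles[OF cochain_complex[OF that(1)], of p] that
    by (auto simp: hom_def red_cohomology_def)
  have closed: "(\<lambda>J. a J + b J) \<in> cocycle_group L' p" if "a \<in> cocycle_group L' p" "b \<in> cocycle_group L' p" for a b
    using group_hom.subgroup_kernel[of "cochain_group L' p" "cochain_group L' (p + 1)" "coboundary L' p"]
      subgroup.m_closed[of "cocycle_group L' p" "cochain_group L' p" a b] that coboundary_hom[of L' p]
    by (simp add: group_hom_def group_hom_axioms_def)
  show ?thesis
    using assms
    by (auto simp: hom_def carrier_red_cohomology red_cohomology_restrict_class[where L' = L'] restrict_cochain_cocycle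
        restrict_cochain_add closed simp flip: cls)
qed

text \<open>Functoriality of the induced maps: removing two vertices one after the other is a single
  restriction, and so does not depend on their order.\<close>

lemma red_cohomology_restrict_restrict:
  assumes "down_closed L" "down_closed L'" "down_closed L''" "L \<subseteq> L'" "L' \<subseteq> L''"
    and "X \<in> carrier (red_cohomology L'' p)"
  shows "red_cohomology_restrict L p (red_cohomology_restrict L' p X) = red_cohomology_restrict L p X"
proof -
  obtain c where c: "c \<in> cocycle_group L'' p" "X = coboundary_group L'' p #>\<^bsub>cochain_group L'' p\<^esub> c"
    using assms by (auto simp: carrier_red_cohomology)
  then show ?thesis
    using assms red_cohomology_restrict_class[of L L'' c p] red_cohomology_restrict_class[of L' L'' c p]
      red_cohomology_restrict_class[of L L' "restrict_cochain L' p c" p] restrict_cochain_cocycle[of L' L'' c p]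
    by (simp add: restrict_cochain_restrict)
qed

section \<open>Ranks of finite direct sums\<close>

lemma carrier_sum_group_finite:
  assumes "finite I" "\<And>i. i \<in> I \<Longrightarrow> comm_group (G i)"
  shows "carrier (sum_group I G) = (\<Pi>\<^sub>E i\<in>I. carrier (G i))"
  using assms by (subst carrier_sum_group) (auto intro: comm_group.axioms(2))

lemma comm_group_sum_group:
  assumes "\<And>i. i \<in> I \<Longrightarrow> comm_group (G i)"
  shows "comm_group (sum_group I G)"
proof (rule group.group_comm_groupI)
  have grp: "group (G i)" if "i \<in> I" for i
    using assms[OF that] by (rule comm_group.axioms(2))
  then show "group (sum_group I G)" by (rule sum_group)
  show "x \<otimes>\<^bsub>sum_group I G\<^esub> y = y \<otimes>\<^bsub>sum_group I G\<^esub> x"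
    if "x \<in> carrier (sum_group I G)" "y \<in> carrier (sum_group I G)" for x y
  proof -
    have "x i \<otimes>\<^bsub>G i\<^esub> y i = y i \<otimes>\<^bsub>G i\<^esub> x i" if "i \<in> I" for i
      using \<open>x \<in> _\<close> \<open>y \<in> _\<close> that assms[OF that] carrier_sum_group[of I G] grp
      by (auto simp: PiE_iff intro!: comm_groupE(4))
    then show ?thesis by (auto simp: restrict_def fun_eq_iff)
  qed
qed

text \<open>By induction, splitting off one summand gives a short exact sequence.\<close>

lemma rank_sum_group:
  assumes "finite I" "\<And>i. i \<in> I \<Longrightarrow> finite_rank (G i)"
  shows "finite_rank (sum_group I G) \<and> abelian_rank (sum_group I G) = (\<Sum>i\<in>I. abelian_rank (G i))"
  using assms
proof (induction I rule: finite_induct)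
  case empty
  have "comm_group (sum_group {} G)" by (rule comm_group_sum_group) auto
  moreover have "carrier (sum_group {} G) \<subseteq> {\<one>\<^bsub>sum_group {} G\<^esub>}"
    by (subst carrier_sum_group_finite) (auto simp: fun_eq_iff)
  ultimately show ?case using trivial_rank[of "sum_group {} G"] by simp
next
  case (insert i I)
  have comm: "comm_group (G j)" if "j \<in> insert i I" for j
    using insert.prems[OF that] by (simp add: finite_rank_def)
  then have one: "\<one>\<^bsub>G j\<^esub> \<in> carrier (G j)" "\<one>\<^bsub>G j\<^esub> \<otimes>\<^bsub>G j\<^esub> \<one>\<^bsub>G j\<^esub> = \<one>\<^bsub>G j\<^esub>" if "j \<in> insert i I" for j
    using that by (auto intro: comm_groupE monoid.r_one comm_group.axioms(2) group.is_monoid)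
  let ?B = "sum_group (insert i I) G" and ?C = "sum_group I G"
  have carrier: "carrier ?B = (\<Pi>\<^sub>E j\<in>insert i I. carrier (G j))" "carrier ?C = (\<Pi>\<^sub>E j\<in>I. carrier (G j))"
    using insert.hyps comm by (auto intro!: carrier_sum_group_finite)
  define f where "f a = (\<lambda>j\<in>insert i I. if j = i then a else \<one>\<^bsub>G j\<^esub>)" for a
  have f_carrier: "f a \<in> carrier ?B" if "a \<in> carrier (G i)" for a
    using that one by (auto simp: f_def carrier)
  have *: "comm_group (G i)" "comm_group ?B" "comm_group ?C"
    using comm by (auto intro: comm_group_sum_group)
  have IH: "finite_rank ?C" "abelian_rank ?C = (\<Sum>j\<in>I. abelian_rank (G j))"
    using insert.IH insert.prems by blast+
  have "f \<in> hom (G i) ?B"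
  proof (rule homI)
    show "f (a \<otimes>\<^bsub>G i\<^esub> b) = f a \<otimes>\<^bsub>?B\<^esub> f b" for a b
      using one by (auto simp: f_def fun_eq_iff restrict_def)
  qed (rule f_carrier)
  moreover have "inj_on f (carrier (G i))"
    by (rule inj_on_inverseI[of _ "\<lambda>x. x i"]) (simp add: f_def)
  moreover have "(\<lambda>x. restrict x I) \<in> hom ?B ?C"
    by (auto simp: hom_def carrier restrict_def PiE_iff extensional_def fun_eq_iff)
  moreover have "(\<lambda>x. restrict x I) ` carrier ?B = carrier ?C"
  proof
    show "(\<lambda>x. restrict x I) ` carrier ?B \<subseteq> carrier ?C"
      by (auto simp: carrier PiE_iff)
    show "carrier ?C \<subseteq> (\<lambda>x. restrict x I) ` carrier ?B"
    proof
      fix y assume y: "y \<in> carrier ?C"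
      show "y \<in> (\<lambda>x. restrict x I) ` carrier ?B"
      proof (rule image_eqI)
        show "y(i := \<one>\<^bsub>G i\<^esub>) \<in> carrier ?B"
          using y one insert.hyps(2) by (auto simp: carrier PiE_iff extensional_def)
        show "y = restrict (y(i := \<one>\<^bsub>G i\<^esub>)) I"
          using y insert.hyps(2) by (auto simp: carrier PiE_iff extensional_def restrict_def fun_eq_iff)
      qed
    qed
  qed
  moreover have "kernel ?B ?C (\<lambda>x. restrict x I) = f ` carrier (G i)"
  proof
    show "f ` carrier (G i) \<subseteq> kernel ?B ?C (\<lambda>x. restrict x I)"
      using f_carrier insert.hyps(2) by (auto simp: kernel_def) (auto simp: f_def restrict_def fun_eq_iff)
    show "kernel ?B ?C (\<lambda>x. restrict x I) \<subseteq> f ` carrier (G i)"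
    proof
      fix x assume x: "x \<in> kernel ?B ?C (\<lambda>x. restrict x I)"
      then have "restrict x I = (\<lambda>j\<in>I. \<one>\<^bsub>G j\<^esub>)" "x \<in> carrier ?B" by (auto simp: kernel_def)
      then have "x j = \<one>\<^bsub>G j\<^esub>" if "j \<in> I" for j using that by (metis restrict_apply')
      with \<open>x \<in> carrier ?B\<close> have "x = f (x i)" "x i \<in> carrier (G i)"
        using insert.hyps(2) by (auto simp: f_def carrier PiE_iff extensional_def restrict_def fun_eq_iff)
      then show "x \<in> f ` carrier (G i)" by blast
    qed
  qed
  moreover have "finite_rank (G i)" using insert.prems by simp
  moreover note IH(1)
  ultimately have "finite_rank ?B" "abelian_rank ?B = abelian_rank (G i) + abelian_rank ?C"
    by (rule rank_short_exact[OF *])+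
  then show ?case
    by (simp only: IH(2) sum.insert[OF insert.hyps] simp_thms)
qed

section \<open>The double complex\<close>

lemma down_closed_full_subcomplex: "down_closed K \<Longrightarrow> down_closed (full_subcomplex K I)"
  unfolding down_closed_def full_subcomplex_def by blast

lemma full_subcomplex_mono: "I \<subseteq> I' \<Longrightarrow> full_subcomplex K I \<subseteq> full_subcomplex K I'"
  by (auto simp: full_subcomplex_def)

lemma finite_simplices_full_subcomplex:
  "finite I \<Longrightarrow> finite (simplices (full_subcomplex K I) p)"
  by (rule finite_subset[of _ "Pow I"]) (auto simp: simplices_def full_subcomplex_def)

lemma finite_vertex_subsets: "finite (vertex_subsets m l)"
  by (rule finite_subset[of _ "Pow {1..m}"]) (auto simp: vertex_subsets_def)

lemma finite_vertex_subset: "I \<in> vertex_subsets m l \<Longrightarrow> finite I"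
  by (rule finite_subset[of _ "{1..m}"]) (simp_all add: vertex_subsets_def)

lemma insert_vertex_subsets:
  assumes "I \<in> vertex_subsets m (l - 1)" "i \<in> {1..m} - I"
  shows "insert i I \<in> vertex_subsets m l"
  using assms finite_vertex_subset[OF assms(1)] by (simp add: vertex_subsets_def)

definition d_summand ::
    "nat set set \<Rightarrow> int \<Rightarrow> nat set \<Rightarrow> (nat set \<Rightarrow> (nat set \<Rightarrow> int) set) \<Rightarrow> nat \<Rightarrow> (nat set \<Rightarrow> int) set" where
  "d_summand K p I x i = psi K p i (insert i I) (x (insert i I))
     [^]\<^bsub>red_cohomology (full_subcomplex K I) p\<^esub> (neg_one_power (p + 1) * eps i (insert i I))"

text \<open>The differential \<open>dprime\<close>, reindexed by the simplicial degree \<open>p = l - k - 1\<close>. It preserves \<open>p\<close>, so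
  for each \<open>p\<close> there is a complex in the single index \<open>l\<close>.\<close>

definition d_total ::
    "nat \<Rightarrow> nat set set \<Rightarrow> int \<Rightarrow> int \<Rightarrow> (nat set \<Rightarrow> (nat set \<Rightarrow> int) set) \<Rightarrow> nat set \<Rightarrow> (nat set \<Rightarrow> int) set" where
  "d_total m K p l x = (\<lambda>I\<in>vertex_subsets m (l - 1).
     finprod (red_cohomology (full_subcomplex K I) p) (d_summand K p I x) ({1..m} - I))"

context
  fixes m :: nat and K :: "nat set set" and p :: int
  assumes K: "down_closed K"
begin

abbreviation Hred where "Hred I \<equiv> red_cohomology (full_subcomplex K I) p"

lemma comm_group_Hred: "comm_group (Hred I)"
  using K by (intro comm_group_red_cohomology down_closed_full_subcomplex)

interpretation R: comm_group "Hred I" for I by (rule comm_group_Hred)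

lemma psi_hom:
  assumes "i \<notin> I"
  shows "psi K p i (insert i I) \<in> hom (Hred (insert i I)) (Hred I)"
proof -
  have "insert i I - {i} = I" using assms by auto
  then show ?thesis
    unfolding psi_def using K
    by (auto intro!: red_cohomology_restrict_hom down_closed_full_subcomplex full_subcomplex_mono)
qed

lemma psi_psi:
  assumes "i \<notin> I" "j \<notin> I" "i \<noteq> j" "x \<in> carrier (Hred (insert j (insert i I)))"
  shows "psi K p i (insert i I) (psi K p j (insert j (insert i I)) x)
    = red_cohomology_restrict (full_subcomplex K I) p x"
proof -
  have "insert i I - {i} = I" "insert j (insert i I) - {j} = insert i I" using assms by auto
  then show ?thesis
    unfolding psi_def
    by (simp, intro red_cohomology_restrict_restrict[OF _ _ _ _ _ assms(4)]
        down_closed_full_subcomplex full_subcomplex_mono K subset_insertI)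
qed

abbreviation Hsum where "Hsum l \<equiv> sum_group (vertex_subsets m l) Hred"

lemma carrier_Hsum: "carrier (Hsum l) = (\<Pi>\<^sub>E I\<in>vertex_subsets m l. carrier (Hred I))"
  using finite_vertex_subsets comm_group_Hred by (rule carrier_sum_group_finite)

lemma d_summand_closed:
  assumes "x \<in> carrier (Hsum l)" "I \<in> vertex_subsets m (l - 1)" "i \<in> {1..m} - I"
  shows "d_summand K p I x i \<in> carrier (Hred I)"
proof -
  have "x (insert i I) \<in> carrier (Hred (insert i I))"
    using assms(1) insert_vertex_subsets[OF assms(2,3)] by (auto simp: carrier_Hsum)
  with assms(3) have "psi K p i (insert i I) (x (insert i I)) \<in> carrier (Hred I)"
    by (intro hom_in_carrier[OF psi_hom]) auto
  then show ?thesis by (simp add: d_summand_def)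
qed

lemma d_total_hom: "d_total m K p l \<in> hom (Hsum l) (Hsum (l - 1))"
proof (rule homI)
  show "d_total m K p l x \<in> carrier (Hsum (l - 1))" if "x \<in> carrier (Hsum l)" for x
    using d_summand_closed[OF that] by (auto simp: d_total_def carrier_Hsum intro!: R.finprod_closed)
  show "d_total m K p l (x \<otimes>\<^bsub>Hsum l\<^esub> y) = d_total m K p l x \<otimes>\<^bsub>Hsum (l - 1)\<^esub> d_total m K p l y"
    if x: "x \<in> carrier (Hsum l)" and y: "y \<in> carrier (Hsum l)" for x y
  proof -
    have "finprod (Hred I) (d_summand K p I (x \<otimes>\<^bsub>Hsum l\<^esub> y)) ({1..m} - I)
        = finprod (Hred I) (d_summand K p I x) ({1..m} - I) \<otimes>\<^bsub>Hred I\<^esub> finprod (Hred I) (d_summand K p I y) ({1..m} - I)"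
      if I: "I \<in> vertex_subsets m (l - 1)" for I
    proof -
      have "d_summand K p I (x \<otimes>\<^bsub>Hsum l\<^esub> y) i = d_summand K p I x i \<otimes>\<^bsub>Hred I\<^esub> d_summand K p I y i" if i: "i \<in> {1..m} - I" for i
      proof -
        have ins: "insert i I \<in> vertex_subsets m l" using I i by (rule insert_vertex_subsets)
        then have xy: "x (insert i I) \<in> carrier (Hred (insert i I))" "y (insert i I) \<in> carrier (Hred (insert i I))"
          using x y by (auto simp: carrier_Hsum)
        have psi: "psi K p i (insert i I) \<in> hom (Hred (insert i I)) (Hred I)" using i psi_hom by auto
        show ?thesis
          using ins hom_mult[OF psi xy] hom_in_carrier[OF psi xy(1)] hom_in_carrier[OF psi xy(2)]
          by (simp add: d_summand_def R.int_pow_distrib)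
      qed
      then have "finprod (Hred I) (d_summand K p I (x \<otimes>\<^bsub>Hsum l\<^esub> y)) ({1..m} - I)
        = finprod (Hred I) (\<lambda>i. d_summand K p I x i \<otimes>\<^bsub>Hred I\<^esub> d_summand K p I y i) ({1..m} - I)"
        using d_summand_closed[OF x I] d_summand_closed[OF y I] by (intro R.finprod_cong') auto
      also have "\<dots> = finprod (Hred I) (d_summand K p I x) ({1..m} - I) \<otimes>\<^bsub>Hred I\<^esub> finprod (Hred I) (d_summand K p I y) ({1..m} - I)"
        using d_summand_closed[OF x I] d_summand_closed[OF y I] by (intro R.finprod_multf) auto
      finally show ?thesis .
    qed
    then show ?thesis
      unfolding d_total_def mult_sum_group[of "vertex_subsets m (l - 1)"]
      by (intro restrict_ext) simp
  qed
qed

text \<open>The component at \<open>I\<close> is a product over ordered pairs of distinct vertices outside \<open>I\<close>. Both orders of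
  a pair contribute powers of the same restricted class, with opposite exponents by
  \<open>eps_anticommute\<close>.\<close>

lemma d_total_d_total:
  assumes x: "x \<in> carrier (Hsum l)"
  shows "d_total m K p (l - 1) (d_total m K p l x) = \<one>\<^bsub>Hsum (l - 1 - 1)\<^esub>"
proof -
  have "finprod (Hred I) (d_summand K p I (d_total m K p l x)) ({1..m} - I) = \<one>\<^bsub>Hred I\<^esub>"
    if I: "I \<in> vertex_subsets m (l - 1 - 1)" for I
  proof -
    let ?V = "{1..m} - I" and ?s = "neg_one_power (p + 1)"
    define r where "r i j = red_cohomology_restrict (full_subcomplex K I) p (x (insert j (insert i I)))" for i j
    define e where "e i j = (?s * eps j (insert j (insert i I))) * (?s * eps i (insert i I))" for i j
    have ins: "insert i I \<in> vertex_subsets m (l - 1)" if "i \<in> ?V" for i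
      using insert_vertex_subsets[OF I that] .
    have xc: "x (insert j (insert i I)) \<in> carrier (Hred (insert j (insert i I)))"
      if "i \<in> ?V" "j \<in> ?V - {i}" for i j
      using x insert_vertex_subsets[OF ins[OF that(1)], of j] that by (auto simp: carrier_Hsum)
    have r_closed: "r i j \<in> carrier (Hred I)" if "i \<in> ?V" "j \<in> ?V - {i}" for i j
    proof -
      have "red_cohomology_restrict (full_subcomplex K I) p \<in> hom (Hred (insert j (insert i I))) (Hred I)"
        using K by (intro red_cohomology_restrict_hom down_closed_full_subcomplex full_subcomplex_mono) auto
      from hom_in_carrier[OF this xc[OF that]] show ?thesis by (simp add: r_def)
    qed
    have summand: "d_summand K p I (d_total m K p l x) i = finprod (Hred I) (\<lambda>j. r i j [^]\<^bsub>Hred I\<^esub> e i j) (?V - {i})"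
      if i: "i \<in> ?V" for i
    proof -
      let ?I = "insert i I"
      have V: "{1..m} - insert i I = {1..m} - I - {i}" by auto
      have closed: "psi K p j (insert j ?I) (x (insert j ?I)) \<in> carrier (Hred ?I)" if "j \<in> ?V - {i}" for j
        using hom_in_carrier[OF psi_hom xc[OF i that]] that by auto
      have psi_i: "psi K p i ?I \<in> hom (Hred ?I) (Hred I)" using i psi_hom by auto
      have "psi K p i ?I (d_total m K p l x ?I) = psi K p i ?I (finprod (Hred ?I) (d_summand K p ?I x) (?V - {i}))"
        by (simp only: d_total_def restrict_apply' ins[OF i] V)
      also have "\<dots> = finprod (Hred I) (\<lambda>j. psi K p i ?I (d_summand K p ?I x j)) (?V - {i})"
        using psi_i closed by (intro hom_finprod comm_group_Hred) (auto simp: d_summand_def)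
      also have "\<dots> = finprod (Hred I) (\<lambda>j. r i j [^]\<^bsub>Hred I\<^esub> (?s * eps j (insert j ?I))) (?V - {i})"
      proof (intro R.finprod_cong' refl)
        show "psi K p i ?I (d_summand K p ?I x j) = r i j [^]\<^bsub>Hred I\<^esub> (?s * eps j (insert j ?I))"
          if j: "j \<in> ?V - {i}" for j
          using i j psi_psi[OF _ _ _ xc[OF i j]] hom_int_pow[OF psi_i closed[OF j]]
          by (simp add: d_summand_def r_def R.is_group)
      qed (use i r_closed in auto)
      finally have "d_summand K p I (d_total m K p l x) i
          = finprod (Hred I) (\<lambda>j. (r i j [^]\<^bsub>Hred I\<^esub> (?s * eps j (insert j ?I))) [^]\<^bsub>Hred I\<^esub> (?s * eps i ?I)) (?V - {i})"
        unfolding d_summand_def using i r_closed by (subst R.finprod_int_pow[symmetric]) auto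
      also have "\<dots> = finprod (Hred I) (\<lambda>j. r i j [^]\<^bsub>Hred I\<^esub> e i j) (?V - {i})"
        using i r_closed by (intro R.finprod_cong') (auto simp: R.int_pow_pow e_def)
      finally show ?thesis .
    qed
    have "finprod (Hred I) (d_summand K p I (d_total m K p l x)) ?V
        = finprod (Hred I) (\<lambda>i. finprod (Hred I) (\<lambda>j. r i j [^]\<^bsub>Hred I\<^esub> e i j) (?V - {i})) ?V"
      using r_closed by (intro R.finprod_cong' summand) auto
    also have "\<dots> = \<one>\<^bsub>Hred I\<^esub>"
    proof (rule R.finprod_antisymmetric)
      fix i j assume ij: "i \<in> ?V" "j \<in> ?V" "i \<noteq> j"
      then show "r i j [^]\<^bsub>Hred I\<^esub> e i j \<in> carrier (Hred I)" using r_closed by auto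
      let ?J = "insert j (insert i I)"
      have J: "?J - {j} = insert i I" "?J - {i} = insert j I" "finite ?J" "?J = insert i (insert j I)"
        using ij finite_vertex_subset[OF I] by auto
      have "eps j ?J * eps i (?J - {j}) = - (eps i ?J * eps j (?J - {i}))"
        using J(3) ij by (intro eps_anticommute) auto
      then have "eps j ?J * eps i (insert i I) = - (eps i ?J * eps j (insert j I))"
        unfolding J(1,2) .
      moreover have "e i j = ?s * ?s * (eps j ?J * eps i (insert i I))"
        unfolding e_def by (simp only: ac_simps)
      moreover have "e j i = ?s * ?s * (eps i ?J * eps j (insert j I))"
        unfolding e_def J(4)[symmetric] by (simp only: ac_simps)
      ultimately have "e j i = - e i j" by simp
      moreover have "r j i = r i j" unfolding r_def J(4)[symmetric] ..
      ultimately show "r i j [^]\<^bsub>Hred I\<^esub> e i j \<otimes>\<^bsub>Hred I\<^esub> r j i [^]\<^bsub>Hred I\<^esub> e j i = \<one>\<^bsub>Hred I\<^esub>"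
        using r_closed[of i j] ij by (simp flip: R.int_pow_mult)
    qed auto
    finally show ?thesis .
  qed
  then show ?thesis
    unfolding d_total_def[of m K p "l - 1"] one_sum_group by (intro restrict_ext) simp
qed

end

lemma dprime_eq_d_total: "dprime m K k l = d_total m K (l - k - 1) l"
  unfolding dprime_def[abs_def] d_total_def[abs_def] d_summand_def[abs_def] Let_def ..

section \<open>Euler characteristics\<close>

lemma neg_one_power_succ:
  "neg_one_power (a + 1) = - neg_one_power a" "neg_one_power (1 + a) = - neg_one_power a"
  by (simp_all add: neg_one_power_def)

text \<open>The telescoping step: the ranks of the images contribute \<open>f k - f (k + 1)\<close> to an Euler characteristic.\<close>

lemma sum_shift_vanishing_ends:
  fixes f :: "int \<Rightarrow> int"
  assumes "0 \<le> M" "f 0 = 0" "f (M + 1) = 0"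
  shows "(\<Sum>k\<in>{0..M}. f (k + 1)) = (\<Sum>k\<in>{0..M}. f k)"
proof -
  have "(\<Sum>k\<in>{0..M}. f (k + 1)) = (\<Sum>k\<in>{1..M + 1}. f k)"
    by (rule sum.reindex_bij_witness[of _ "\<lambda>k. k - 1" "\<lambda>k. k + 1"]) auto
  also have "\<dots> = (\<Sum>k\<in>{1..M}. f k)"
  proof -
    have "{1..M + 1} = insert (M + 1) {1..M}" using assms(1) by auto
    then show ?thesis using assms(3) by simp
  qed
  also have "\<dots> = (\<Sum>k\<in>{0..M}. f k)"
  proof -
    have "{0..M} = insert 0 {1..M}" using assms(1) by auto
    then show ?thesis using assms(2) by simp
  qed
  finally show ?thesis .
qed

text \<open>At bidegree \<open>(k, l)\<close> all three groups have the same simplicial degree \<open>l - k - 1\<close>, so they are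
  consecutive terms of one of the complexes above.\<close>

lemma HH_complex:
  assumes "down_closed K"
  shows "three_term_complex (H_ZK m K (k + 1) (l + 1)) (H_ZK m K k l) (H_ZK m K (k - 1) (l - 1))
    (dprime m K (k + 1) (l + 1)) (dprime m K k l)"
proof -
  define p where "p = l - k - 1"
  have H: "H_ZK m K k l = sum_group (vertex_subsets m l) (\<lambda>I. red_cohomology (full_subcomplex K I) p)"
    "H_ZK m K (k + 1) (l + 1) = sum_group (vertex_subsets m (l + 1)) (\<lambda>I. red_cohomology (full_subcomplex K I) p)"
    "H_ZK m K (k - 1) (l - 1) = sum_group (vertex_subsets m (l - 1)) (\<lambda>I. red_cohomology (full_subcomplex K I) p)"
    by (simp_all add: H_ZK_def p_def)
  have d: "dprime m K (k + 1) (l + 1) = d_total m K p (l + 1)" "dprime m K k l = d_total m K p l"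
    by (simp_all add: dprime_eq_d_total p_def)
  have comm: "comm_group (sum_group (vertex_subsets m l) (\<lambda>I. red_cohomology (full_subcomplex K I) p))" for l
    by (intro comm_group_sum_group comm_group_Hred assms)
  show ?thesis
    unfolding H d three_term_complex_def three_term_complex_axioms_def
  proof (intro conjI comm allI impI)
    show "d_total m K p l (d_total m K p (l + 1) x)
        = \<one>\<^bsub>sum_group (vertex_subsets m (l - 1)) (\<lambda>I. red_cohomology (full_subcomplex K I) p)\<^esub>"
      if "x \<in> carrier (sum_group (vertex_subsets m (l + 1)) (\<lambda>I. red_cohomology (full_subcomplex K I) p))" for x
      using d_total_d_total[OF assms that] by (simp only: add_diff_cancel_right')
  qed (use d_total_hom[OF assms, of m p "l + 1"] d_total_hom[OF assms, of m p l] in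
      \<open>simp_all only: add_diff_cancel_right'\<close>)
qed

lemma finite_rank_H_ZK:
  assumes "down_closed K"
  shows "finite_rank (H_ZK m K k l)"
    and "abelian_rank (H_ZK m K k l)
      = (\<Sum>I\<in>vertex_subsets m l. abelian_rank (red_cohomology (full_subcomplex K I) (l - k - 1)))"
proof -
  have "finite_rank (red_cohomology (full_subcomplex K I) (l - k - 1))" if "I \<in> vertex_subsets m l" for I
    using that by (intro finite_rank_red_cohomology down_closed_full_subcomplex assms
        finite_simplices_full_subcomplex finite_vertex_subset)
  from rank_sum_group[OF finite_vertex_subsets, of m l "\<lambda>I. red_cohomology (full_subcomplex K I) (l - k - 1)", OF this]
  show "finite_rank (H_ZK m K k l)"
    and "abelian_rank (H_ZK m K k l)
      = (\<Sum>I\<in>vertex_subsets m l. abelian_rank (red_cohomology (full_subcomplex K I) (l - k - 1)))"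
    unfolding H_ZK_def by blast+
qed

definition d_rank :: "nat \<Rightarrow> nat set set \<Rightarrow> int \<Rightarrow> int \<Rightarrow> nat" where
  "d_rank m K k l = abelian_rank (subgroup_generated (H_ZK m K (k - 1) (l - 1)) (dprime m K k l ` carrier (H_ZK m K k l)))"

lemma rank_HH_ZK:
  assumes "down_closed K"
  shows "abelian_rank (H_ZK m K k l) = abelian_rank (HH_ZK m K k l) + d_rank m K (k + 1) (l + 1) + d_rank m K k l"
  using three_term_complex.rank_cohomology[OF HH_complex[OF assms] finite_rank_H_ZK(1)[OF assms], of m k l]
  by (simp add: HH_ZK_def d_rank_def)

definition coboundary_rank :: "nat set set \<Rightarrow> int \<Rightarrow> nat" where
  "coboundary_rank L p = abelian_rank (subgroup_generated (cochain_group L p) (coboundary_group L p))"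

lemma card_simplices_eq:
  assumes "down_closed K" "finite I"
  shows "card (simplices (full_subcomplex K I) p) = abelian_rank (red_cohomology (full_subcomplex K I) p)
    + coboundary_rank (full_subcomplex K I) p + coboundary_rank (full_subcomplex K I) (p + 1)"
  using rank_red_cohomology[OF down_closed_full_subcomplex finite_simplices_full_subcomplex] assms
  by (simp add: coboundary_rank_def)

lemma simplices_full_subcomplex_empty:
  assumes "finite I" "p \<ge> int (card I) \<or> p < - 1"
  shows "simplices (full_subcomplex K I) p = {}"
proof -
  have False if "J \<in> simplices (full_subcomplex K I) p" for J
  proof -
    have "J \<subseteq> I" "int (card J) = p + 1" using that by (auto simp: simplices_def full_subcomplex_def)
    with card_mono[OF assms(1) this(1)] assms(2) show False by linarith
  qed
  then show ?thesis by blast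
qed

text \<open>A full subcomplex on \<open>l\<close> vertices has simplices only in dimensions from \<open>-1\<close> to \<open>l - 1\<close>. This bounds
  the bidegrees and makes the boundary terms of the telescoping sums vanish.\<close>

lemma rank_H_ZK_eq_0:
  assumes "down_closed K" "k < 0 \<or> l < k \<or> int m < l"
  shows "abelian_rank (H_ZK m K k l) = 0"
proof -
  have "abelian_rank (red_cohomology (full_subcomplex K I) (l - k - 1)) = 0" if I: "I \<in> vertex_subsets m l" for I
  proof -
    have card: "int (card I) = l" "I \<subseteq> {1..m}" "finite I"
      using I finite_vertex_subset[OF I] by (auto simp: vertex_subsets_def)
    then have "l \<le> int m" using card_mono[of "{1..m}" I] by simp
    then have "simplices (full_subcomplex K I) (l - k - 1) = {}"
      using assms(2) card by (intro simplices_full_subcomplex_empty) auto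
    then show ?thesis using card_simplices_eq[OF assms(1) card(3), of "l - k - 1"] by simp
  qed
  then show ?thesis by (simp add: finite_rank_H_ZK[OF assms(1)])
qed

text \<open>The rank of a differential is lost both at its source \<open>(k, l)\<close> and at its target
  \<open>(k - 1, l - 1)\<close>, which carry opposite signs. Both sums run over the square \<open>0 \<le> k, l \<le> m\<close>,
  outside which all ranks vanish.\<close>

lemma HH_euler_characteristic_eq:
  assumes "down_closed K"
  shows "HH_euler_characteristic m K
    = (\<Sum>k\<in>{0..int m}. \<Sum>l\<in>{0..int m}. neg_one_power k * int (abelian_rank (H_ZK m K k l)))"
proof -
  define g where "g k l = neg_one_power k * int (d_rank m K k l)" for k l
  have r: "abelian_rank (H_ZK m K k l) = abelian_rank (HH_ZK m K k l) + d_rank m K (k + 1) (l + 1) + d_rank m K k l" for k l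
    by (rule rank_HH_ZK[OF assms])
  have le: "d_rank m K k l \<le> abelian_rank (H_ZK m K k l)" 
    "d_rank m K k l \<le> abelian_rank (H_ZK m K (k - 1) (l - 1))" for k l
    using r[of k l] r[of "k - 1" "l - 1"] by simp_all
  \<comment> \<open>a differential that starts or ends outside the square has rank zero\<close>
  have g0: "g k l = 0" if "k \<le> 0 \<or> k > int m \<or> l \<le> 0 \<or> l > int m" for k l
  proof -
    have "d_rank m K k l = 0"
    proof (cases "k < 1 \<or> l < k")
      case True
      then have "abelian_rank (H_ZK m K (k - 1) (l - 1)) = 0"
        by (intro rank_H_ZK_eq_0 assms) auto
      then show ?thesis using le(2)[of k l] by simp
    next
      case False
      with that have "int m < l" by auto
      then have "abelian_rank (H_ZK m K k l) = 0"
        by (intro rank_H_ZK_eq_0 assms) auto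
      then show ?thesis using le(1)[of k l] by simp
    qed
    then show ?thesis by (simp add: g_def)
  qed
  have "(\<Sum>k\<in>{0..int m}. \<Sum>l\<in>{0..int m}. g k l) = (\<Sum>k\<in>{0..int m}. \<Sum>l\<in>{0..int m}. g (k + 1) l)"
    by (rule sum_shift_vanishing_ends[symmetric]) (auto simp: g0)
  also have "\<dots> = (\<Sum>k\<in>{0..int m}. \<Sum>l\<in>{0..int m}. g (k + 1) (l + 1))"
    by (intro sum.cong refl sum_shift_vanishing_ends[symmetric]) (auto simp: g0)
  finally have g: "(\<Sum>k\<in>{0..int m}. \<Sum>l\<in>{0..int m}. g k l - g (k + 1) (l + 1)) = 0"
    by (simp add: sum_subtractf)
  have "(\<Sum>k\<in>{0..int m}. \<Sum>l\<in>{0..int m}. neg_one_power k * int (abelian_rank (H_ZK m K k l)))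
      = (\<Sum>k\<in>{0..int m}. \<Sum>l\<in>{0..int m}. neg_one_power (- k + 2 * l) * int (abelian_rank (HH_ZK m K k l))
          + (g k l - g (k + 1) (l + 1)))"
  proof (intro sum.cong refl)
    fix k l
    have "neg_one_power (- k + 2 * l) = neg_one_power k" by (simp add: neg_one_power_def)
    then show "neg_one_power k * int (abelian_rank (H_ZK m K k l))
      = neg_one_power (- k + 2 * l) * int (abelian_rank (HH_ZK m K k l)) + (g k l - g (k + 1) (l + 1))"
      by (simp add: r g_def neg_one_power_succ algebra_simps)
  qed
  also have "\<dots> = HH_euler_characteristic m K"
    using g by (simp add: sum.distrib HH_euler_characteristic_def)
  finally show ?thesis by simp
qed

text \<open>The Euler characteristic of \<open>K\<^sub>I\<close> counted by simplices. A simplex \<open>J\<close> of \<open>K\<^sub>I\<close> has dimension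
  \<open>|I| - k - 1\<close> for \<open>k = |I| - |J|\<close>.\<close>

lemma euler_full_subcomplex:
  assumes "down_closed K" "I \<subseteq> {1..m}"
  shows "(\<Sum>k\<in>{0..int m}. neg_one_power k * int (abelian_rank (red_cohomology (full_subcomplex K I) (int (card I) - k - 1))))
    = (\<Sum>J\<in>full_subcomplex K I. (- 1) ^ (card I + card J))"
proof -
  let ?L = "full_subcomplex K I" and ?n = "int (card I)"
  have fin: "finite I" using assms(2) by (rule finite_subset) simp
  have n: "?n \<le> int m" using card_mono[OF _ assms(2)] by simp
  define f where "f k = neg_one_power k * int (coboundary_rank ?L (?n - k))" for k
  note c = card_simplices_eq[OF assms(1) fin]
  have "coboundary_rank ?L ?n = 0"
    using c[of ?n] simplices_full_subcomplex_empty[OF fin, of ?n K] by simp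
  then have f0: "f 0 = 0" by (simp add: f_def)
  have "coboundary_rank ?L (?n - (int m + 1)) = 0"
    using c[of "?n - int m - 2"] simplices_full_subcomplex_empty[OF fin, of "?n - int m - 2" K] n
    by (simp add: algebra_simps)
  then have f1: "f (int m + 1) = 0" by (simp add: f_def)
  have "neg_one_power k * int (card (simplices ?L (?n - k - 1)))
      = neg_one_power k * int (abelian_rank (red_cohomology ?L (?n - k - 1))) + (f k - f (k + 1))" for k
  proof -
    have "?n - k - 1 = ?n - (k + 1)" "?n - k - 1 + 1 = ?n - k" by simp_all
    then show ?thesis
      using c[of "?n - k - 1"] by (simp add: f_def neg_one_power_succ algebra_simps)
  qed
  then have "(\<Sum>k\<in>{0..int m}. neg_one_power k * int (abelian_rank (red_cohomology ?L (?n - k - 1))))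
      = (\<Sum>k\<in>{0..int m}. neg_one_power k * int (card (simplices ?L (?n - k - 1))))"
    using sum_shift_vanishing_ends[of "int m" f, OF _ f0 f1] by (simp add: sum.distrib sum_subtractf)
  also have "\<dots> = (\<Sum>k\<in>{0..int m}. \<Sum>J\<in>{J \<in> ?L. ?n - int (card J) = k}. (- 1) ^ (card I + card J))"
  proof (intro sum.cong refl)
    fix k
    have eq: "simplices ?L (?n - k - 1) = {J \<in> ?L. ?n - int (card J) = k}"
      using finite_subset[OF _ fin] by (auto simp: simplices_def full_subcomplex_def)
    have "(\<Sum>J\<in>{J \<in> ?L. ?n - int (card J) = k}. (- 1) ^ (card I + card J))
        = (\<Sum>J\<in>{J \<in> ?L. ?n - int (card J) = k}. neg_one_power k)"
    proof (intro sum.cong refl)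
      fix J assume "J \<in> {J \<in> ?L. ?n - int (card J) = k}"
      then have "even k \<longleftrightarrow> even (card I + card J)" by auto
      then show "(- 1) ^ (card I + card J) = neg_one_power k" by (simp add: neg_one_power_def)
    qed
    then show "neg_one_power k * int (card (simplices ?L (?n - k - 1)))
        = (\<Sum>J\<in>{J \<in> ?L. ?n - int (card J) = k}. (- 1) ^ (card I + card J))"
      by (simp add: eq)
  qed
  also have "\<dots> = (\<Sum>J\<in>?L. (- 1) ^ (card I + card J))"
  proof (rule sum.group)
    show "finite ?L" by (rule finite_subset[of _ "Pow I"]) (auto simp: full_subcomplex_def fin)
    have "card J \<le> card I" if "J \<in> ?L" for J
      using that fin by (intro card_mono) (auto simp: full_subcomplex_def)
    then show "(\<lambda>J. ?n - int (card J)) ` ?L \<subseteq> {0..int m}"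
      using n by fastforce
  qed simp
  finally show ?thesis .
qed

text \<open>Toggling an element of \<open>V\<close> outside \<open>J\<close> pairs the sets of even size with those of odd size.\<close>

lemma alternating_sum_between:
  assumes "finite V" "J \<subset> V"
  shows "(\<Sum>I\<in>{I \<in> Pow V. J \<subseteq> I}. (- 1) ^ (card I + card J)) = (0 :: int)"
proof -
  have eq: "{I \<in> Pow V. J \<subseteq> I} = {I. J \<subseteq> I \<and> I \<subseteq> V}" by auto
  have "(\<Sum>I\<in>{I. J \<subseteq> I \<and> I \<subseteq> V}. (- 1) ^ card I) = (0 :: int)"
    using card_subsupersets_even_odd[OF assms] assms(1)
    by (intro sum_alternating_cancels) (auto simp: conj_ac)
  then show ?thesis
    unfolding eq by (simp add: power_add flip: sum_distrib_right)
qed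

theorem corollary4p6:
  fixes m :: nat and K :: "nat set set"
  assumes "complex_on m K"
    and "K \<noteq> Pow {1..m}"
  shows "HH_euler_characteristic m K = 0"
proof -
  let ?V = "{1..m}"
  have K: "down_closed K" "K \<subseteq> Pow ?V"
    using assms(1) by (auto simp: complex_on_def down_closed_def)
  \<comment> \<open>otherwise \<open>K\<close>, being closed under subsets, would be the full simplex\<close>
  have "?V \<notin> K"
    using K assms(2) unfolding down_closed_def by blast
  then have proper: "J \<subset> ?V" if "J \<in> K" for J using that K(2) by auto
  let ?h = "\<lambda>I k. neg_one_power k * int (abelian_rank (red_cohomology (full_subcomplex K I) (int (card I) - k - 1)))"
  have vs: "vertex_subsets m l = {I \<in> Pow ?V. int (card I) = l}" for l
    by (auto simp: vertex_subsets_def)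
  have "HH_euler_characteristic m K = (\<Sum>k\<in>{0..int m}. \<Sum>l\<in>{0..int m}. \<Sum>I\<in>{I \<in> Pow ?V. int (card I) = l}. ?h I k)"
    unfolding HH_euler_characteristic_eq[OF K(1)] finite_rank_H_ZK(2)[OF K(1)] vs
    by (intro sum.cong refl) (auto simp: sum_distrib_left intro!: sum.cong)
  also have "\<dots> = (\<Sum>k\<in>{0..int m}. \<Sum>I\<in>Pow ?V. ?h I k)"
  proof (intro sum.cong refl sum.group)
    have "card I \<le> m" if "I \<subseteq> ?V" for I using card_mono[OF _ that] by simp
    then show "(\<lambda>I. int (card I)) ` Pow ?V \<subseteq> {0..int m}" by auto
  qed auto
  also have "\<dots> = (\<Sum>I\<in>Pow ?V. \<Sum>k\<in>{0..int m}. ?h I k)" by (rule sum.swap)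
  also have "\<dots> = (\<Sum>I\<in>Pow ?V. \<Sum>J\<in>{J \<in> K. J \<subseteq> I}. (- 1) ^ (card I + card J))"
  proof (intro sum.cong refl)
    show "(\<Sum>k\<in>{0..int m}. ?h I k) = (\<Sum>J\<in>{J \<in> K. J \<subseteq> I}. (- 1) ^ (card I + card J))" if "I \<in> Pow ?V" for I
      using euler_full_subcomplex[OF K(1), of I m] that by (simp add: full_subcomplex_def)
  qed
  also have "\<dots> = (\<Sum>J\<in>K. \<Sum>I\<in>{I \<in> Pow ?V. J \<subseteq> I}. (- 1) ^ (card I + card J))"
    using finite_subset[OF K(2)] by (intro sum.swap_restrict) auto
  also have "\<dots> = 0"
    using proper by (intro sum.neutral ballI alternating_sum_between) auto
  finally show ?thesis .
qed

end
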